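(* Let $(\mathcal X_0,\mathfrak S_0)$ and $(\mathcal X_1,\mathfrak S_1)$ be hierarchically hyperbolic spaces. Then $\mathcal X=\mathcal X_0\times\mathcal X_1$ admits a hierarchically hyperbolic structure $(\mathcal X,\mathfrak S)$ such that for each $i\in\{0,1\}$ the inclusion map $\mathcal X_i\to\mathcal X$ (as a factor, with the other coordinate a fixed basepoint) induces a quasiconvex hieromorphism $(\mathcal X_i,\mathfrak S_i)\to(\mathcal X,\mathfrak S)$.
   Context: The product carries a product metric (e.g. the $\ell^1$ metric). Hierarchically hyperbolic spaces (HHS). A $q$-quasigeodesic space is a metric space in which any two points are joined by a $(q,q)$-quasigeodesic. A $q$-quasigeodesic space $(\mathcal X,d_{\mathcal X})$ is an HHS (with structure $\mathfrak S$; one writes $(\mathcal X,\mathfrak S)$) if there are $\delta\ge0$, an index set $\mathfrak S$ and $\delta$-hyperbolic geodesic spaces $(\mathcal CW,d_W)$, $W\in\mathfrak S$, such that (1)–(9) below hold. Conventions: the distance between two sets is the infimum of distances between their points; for $x,y\in\mathcal X$ and $p\subseteq\mathcal CW$, $d_W(x,y)=d_W(\pi_W(x),\pi_W(y))$ and $d_W(x,p)=d_W(\pi_W(x),p)$; $\pi_W(A)=\bigcup_{a\in A}\pi_W(a)$; $V\sqsubset W$ means $V\sqsubseteq W$ and $V\ne W$. (1) Projections: there are $\xi,K\ge 0$ and maps $\pi_W:\mathcal X\to2^{\mathcal CW}$ ($W\in\mathfrak S$) sending points to nonempty sets of diameter $\le\xi$; each $\pi_W$ is $(K,K)$-coarsely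 Lipschitz and $\pi_W(\mathcal X)$ is $K$-quasiconvex in $\mathcal CW$. (2) Nesting: $\mathfrak S$ has a partial order $\sqsubseteq$, and either $\mathfrak S=\emptyset$ or there is a unique $\sqsubseteq$-maximal element. Put $\mathfrak S_W=\{V:V\sqsubseteq W\}$. If $V\sqsubset W$ there is a specified subset $\rho^V_W\subset\mathcal CW$ of diameter $\le\xi$ and a map $\rho^W_V:\mathcal CW\to2^{\mathcal CV}$. (3) Orthogonality: $\mathfrak S$ has a symmetric anti-reflexive relation $\perp$. If $V\sqsubseteq W$ and $W\perp U$ then $V\perp U$. For each $T\in\mathfrak S$ and $U\in\mathfrak S_T$ with $\{V\in\mathfrak S_T:V\perp U\}\ne\emptyset$ there is $W\in\mathfrak S_T-\{T\}$ such that $V\sqsubseteq W$ whenever $V\perp U$ and $V\sqsubseteq T$. If $V\perp W$ then $V,W$ are not $\sqsubseteq$-comparable. (4) Transversality and consistency: if $V,W$ are not orthogonal and neither is nested in the other they are transverse, $V\pitchfork W$. There is $\kappa_0\ge0$ such that: if $V\pitchfork W$ there are sets $\rho^V_W\subseteq\mathcal CW$, $\rho^W_V\subseteq\mathcal CV$ of diameter $\le\xi$ with $\min\{d_W(\pi_W(x),\rho^V_W),d_V(\pi_V(x),\rho^W_V)\}\le\kappa_0$ for all $x\in\mathcal X$; if $V\sqsubset W$ then $\min\{d_W(\pi_W(x),\rho^V_W),\mathrm{diam}_{\mathcal CV}(\pi_V(x)\cup\rho^W_V(\pi_W(x)))\}\le\kappa_0$ for all $x$; and if $U\sqsubseteq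 V$ then $d_W(\rho^U_W,\rho^V_W)\le\kappa_0$ whenever $V\sqsubset W$, or $V\pitchfork W$ and $W\not\perp U$. (5) Finite complexity: there is $n\ge0$ (the complexity) such that any set of pairwise $\sqsubseteq$-comparable elements has at most $n$ elements. (6) Large links: there are $\lambda\ge1$, $E\ge\max\{\xi,\kappa_0\}$ such that for $W\in\mathfrak S$, $x,x'\in\mathcal X$ and $N=\lambda d_W(x,x')+\lambda$ there is a collection $\{T_i\}\subseteq\mathfrak S_W-\{W\}$ of at most $\lfloor N\rfloor$ elements such that every $T\in\mathfrak S_W-\{W\}$ either lies in some $\mathfrak S_{T_i}$ or satisfies $d_T(x,x')<E$; moreover $d_W(x,\rho^{T_i}_W)\le N$ for all $i$. (7) Bounded geodesic image: there is $E>0$ such that for all $V\sqsubset W$ and all geodesics $\gamma$ of $\mathcal CW$, either $\mathrm{diam}_{\mathcal CV}(\rho^W_V(\gamma))\le E$ or $\gamma$ meets the $E$-neighborhood of $\rho^V_W$. (8) Partial realization: there is $\alpha$ such that for every family $\{V_j\}$ of pairwise orthogonal elements and $p_j\in\pi_{V_j}(\mathcal X)$ there is $x\in\mathcal X$ with $d_{V_j}(x,p_j)\le\alpha$ for all $j$, and $d_V(x,\rho^{V_j}_V)\le\alpha$ whenever $V_j\sqsubset V$ or $V\pitchfork V_j$ for some $j$. (9) Uniqueness: for each $\kappa\ge0$ there is $\theta_u(\kappa)$ such that $d_{\mathcal X}(x,y)\ge\theta_u(\kappa)$ implies $d_V(x,y)\ge\kappa$ for some $V\in\mathfrak S$. Hieromorphisms.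 A hieromorphism $(\mathcal X,\mathfrak S)\to(\mathcal X',\mathfrak S')$ consists of a map $f:\mathcal X\to\mathcal X'$, an injective map $f^{\diamondsuit}:\mathfrak S\to\mathfrak S'$ preserving nesting, transversality and orthogonality, and maps $f^*(U):\mathcal CU\to\mathcal C(f^{\diamondsuit}(U))$ that are quasi-isometric embeddings with constants uniform in $U\in\mathfrak S$, such that, up to uniformly bounded error, $\pi_{f^\diamondsuit(U)}\circ f=f^*(U)\circ\pi_U$ for all $U$, and $f^*(V)\circ\rho^U_V=\rho^{f^\diamondsuit(U)}_{f^\diamondsuit(V)}\circ f^*(U)$ for all distinct non-orthogonal $U,V$ (where $\rho^U_V$ is viewed as a constant coarse map if $U\pitchfork V$ or $U\sqsubset V$). It is quasiconvex if $f$ is a quasi-isometric embedding and its image is $k$-hierarchically quasiconvex for some $k$. Hierarchical quasiconvexity. For $k:[0,\infty)\to[0,\infty)$, a subset $\mathcal Y\subseteq\mathcal X$ is $k$-hierarchically quasiconvex if $\pi_U(\mathcal Y)$ is $k(0)$-quasiconvex in $\mathcal CU$ for all $U\in\mathfrak S$, and for every $\kappa>0$, every $x\in\mathcal X$ with $d_U(\pi_U(x),\pi_U(\mathcal Y))\le\kappa$ for all $U\in\mathfrak S$ satisfies $d_{\mathcal X}(x,\mathcal Y)\le k(\kappa)$. *)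

theory Defs
  imports "HOL-Analysis.Analysis"
begin

section \<open>Coarse geometry of metric spaces\<close>

text \<open>
  Metric spaces are elements of the type \<^typ>\<open>'a metric\<close>, so that the carrier is a subset of
  the type. Distances between sets and diameters take values in \<^typ>\<open>ennreal\<close>: thus the infimum
  over the empty set is infinite and the diameter of the empty set is 0.
\<close>

definition set_dist :: "'a metric \<Rightarrow> 'a set \<Rightarrow> 'a set \<Rightarrow> ennreal" where
  "set_dist m A B = (INF a\<in>A. INF b\<in>B. ennreal (mdist m a b))"

definition set_diam :: "'a metric \<Rightarrow> 'a set \<Rightarrow> ennreal" where
  "set_diam m A = (SUP a\<in>A. SUP b\<in>A. ennreal (mdist m a b))"

text \<open>Each of the two sets lies in the closed \<open>r\<close>-neighbourhood of the other.\<close>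

definition coarsely_equal :: "'a metric \<Rightarrow> real \<Rightarrow> 'a set \<Rightarrow> 'a set \<Rightarrow> bool" where
  "coarsely_equal m r A B \<longleftrightarrow>
     (\<forall>a\<in>A. set_dist m {a} B \<le> ennreal r) \<and> (\<forall>b\<in>B. set_dist m {b} A \<le> ennreal r)"

definition l1_prod_metric :: "'a metric \<Rightarrow> 'b metric \<Rightarrow> ('a \<times> 'b) metric" where
  "l1_prod_metric m n =
     metric (mspace m \<times> mspace n, \<lambda>(x, y) (x', y'). mdist m x x' + mdist n y y')"

lemma Metric_space_l1_prod:
  "Metric_space (mspace m \<times> mspace n) (\<lambda>(x, y) (x', y'). mdist m x x' + mdist n y y')"
proof
  show "0 \<le> (case p of (x, y) \<Rightarrow> \<lambda>(x', y'). mdist m x x' + mdist n y y') q" for p q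
    by (auto split: prod.splits)
  show "(case p of (x, y) \<Rightarrow> \<lambda>(x', y'). mdist m x x' + mdist n y y') q
      = (case q of (x, y) \<Rightarrow> \<lambda>(x', y'). mdist m x x' + mdist n y y') p" for p q
    by (auto simp: mdist_commute split: prod.splits)
  show "((case p of (x, y) \<Rightarrow> \<lambda>(x', y'). mdist m x x' + mdist n y y') q = 0) = (p = q)"
    if "p \<in> mspace m \<times> mspace n" "q \<in> mspace m \<times> mspace n" for p q
    using that by (auto simp: add_nonneg_eq_0_iff split: prod.splits)
  show "(case p of (x, y) \<Rightarrow> \<lambda>(x', y'). mdist m x x' + mdist n y y') r
      \<le> (case p of (x, y) \<Rightarrow> \<lambda>(x', y'). mdist m x x' + mdist n y y') q
       + (case q of (x, y) \<Rightarrow> \<lambda>(x', y'). mdist m x x' + mdist n y y') r"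
    if "p \<in> mspace m \<times> mspace n" "q \<in> mspace m \<times> mspace n" "r \<in> mspace m \<times> mspace n" for p q r
  proof -
    obtain p1 p2 q1 q2 r1 r2 where [simp]: "p = (p1, p2)" "q = (q1, q2)" "r = (r1, r2)"
      by (metis surj_pair)
    show ?thesis
      using that mdist_triangle[of p1 m q1 r1] mdist_triangle[of p2 n q2 r2] by auto
  qed
qed

lemma mspace_l1_prod_metric [simp]: "mspace (l1_prod_metric m n) = mspace m \<times> mspace n"
  unfolding l1_prod_metric_def by (rule Metric_space.mspace_metric[OF Metric_space_l1_prod])

lemma mdist_l1_prod_metric [simp]:
  "mdist (l1_prod_metric m n) (x, y) (x', y') = mdist m x x' + mdist n y y'"
  unfolding l1_prod_metric_def by (simp add: Metric_space.mdist_metric[OF Metric_space_l1_prod])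

definition qi_embedding :: "real \<Rightarrow> 'a metric \<Rightarrow> 'b metric \<Rightarrow> ('a \<Rightarrow> 'b) \<Rightarrow> bool" where
  "qi_embedding q m n f \<longleftrightarrow>
     f ` mspace m \<subseteq> mspace n \<and>
     (\<forall>x\<in>mspace m. \<forall>y\<in>mspace m.
        mdist m x y / q - q \<le> mdist n (f x) (f y) \<and> mdist n (f x) (f y) \<le> q * mdist m x y + q)"

text \<open>A \<open>(q,q)\<close>-quasigeodesic is a \<open>(q,q)\<close>-quasi-isometric embedding of an interval.\<close>

definition quasigeodesic_space :: "real \<Rightarrow> 'a metric \<Rightarrow> bool" where
  "quasigeodesic_space q m \<longleftrightarrow>
     (\<forall>x\<in>mspace m. \<forall>y\<in>mspace m. \<exists>L\<ge>0. \<exists>\<gamma>.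
        qi_embedding q (submetric euclidean_metric {0..L::real}) m \<gamma> \<and> \<gamma> 0 = x \<and> \<gamma> L = y)"

text \<open>\<open>P\<close> is the image of a geodesic from \<open>x\<close> to \<open>y\<close>.\<close>

definition geodesic_segment :: "'a metric \<Rightarrow> 'a \<Rightarrow> 'a \<Rightarrow> 'a set \<Rightarrow> bool" where
  "geodesic_segment m x y P \<longleftrightarrow>
     (\<exists>L\<ge>0. \<exists>\<gamma> :: real \<Rightarrow> 'a.
        \<gamma> ` {0..L} \<subseteq> mspace m \<and>
        (\<forall>s\<in>{0..L}. \<forall>t\<in>{0..L}. mdist m (\<gamma> s) (\<gamma> t) = \<bar>s - t\<bar>) \<and>
        \<gamma> 0 = x \<and> \<gamma> L = y \<and> P = \<gamma> ` {0..L})"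

definition geodesic_space :: "'a metric \<Rightarrow> bool" where
  "geodesic_space m \<longleftrightarrow> (\<forall>x\<in>mspace m. \<forall>y\<in>mspace m. \<exists>P. geodesic_segment m x y P)"

text \<open>Hyperbolicity in the sense of slim geodesic triangles.\<close>

definition hyperbolic :: "real \<Rightarrow> 'a metric \<Rightarrow> bool" where
  "hyperbolic \<delta> m \<longleftrightarrow>
     (\<forall>x y z P Q R. geodesic_segment m x y P \<and> geodesic_segment m y z Q \<and> geodesic_segment m z x R \<longrightarrow>
        (\<forall>p\<in>P. set_dist m {p} (Q \<union> R) \<le> ennreal \<delta>))"

definition quasiconvex :: "real \<Rightarrow> 'a metric \<Rightarrow> 'a set \<Rightarrow> bool" where
  "quasiconvex k m A \<longleftrightarrow>
     A \<subseteq> mspace m \<and>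
     (\<forall>x\<in>A. \<forall>y\<in>A. \<forall>P. geodesic_segment m x y P \<longrightarrow> (\<forall>p\<in>P. set_dist m {p} A \<le> ennreal k))"


section \<open>Hierarchically hyperbolic spaces\<close>

text \<open>
  The data of a hierarchically hyperbolic structure on a space with points in \<^typ>\<open>'a\<close>. The set
  \<open>\<rho>\<^sup>V\<^sub>W\<close>, for \<open>V\<close> properly nested in or transverse to \<open>W\<close>, is \<open>rho_set V W\<close>, a subset of the
  space of \<open>W\<close>. The map \<open>\<rho>\<^sup>W\<^sub>V\<close>, for \<open>V\<close> properly nested in \<open>W\<close>, is \<open>rho_map W V\<close>, from the
  space of \<open>W\<close> to subsets of the space of \<open>V\<close>. Values of the fields outside these ranges (in
  particular on indices not in \<open>domains\<close>) are irrelevant.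
\<close>

record ('a, 'i, 'c) hhs_structure =
  domains :: "'i set"
  hyp_space :: "'i \<Rightarrow> 'c metric"
  proj :: "'i \<Rightarrow> 'a \<Rightarrow> 'c set"
  nested :: "'i \<Rightarrow> 'i \<Rightarrow> bool"
  orth :: "'i \<Rightarrow> 'i \<Rightarrow> bool"
  rho_set :: "'i \<Rightarrow> 'i \<Rightarrow> 'c set"
  rho_map :: "'i \<Rightarrow> 'i \<Rightarrow> 'c \<Rightarrow> 'c set"

definition pnested :: "('a, 'i, 'c) hhs_structure \<Rightarrow> 'i \<Rightarrow> 'i \<Rightarrow> bool" where
  "pnested S V W \<longleftrightarrow> nested S V W \<and> V \<noteq> W"

definition transverse :: "('a, 'i, 'c) hhs_structure \<Rightarrow> 'i \<Rightarrow> 'i \<Rightarrow> bool" where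
  "transverse S V W \<longleftrightarrow> \<not> orth S V W \<and> \<not> nested S V W \<and> \<not> nested S W V"

definition domains_below :: "('a, 'i, 'c) hhs_structure \<Rightarrow> 'i \<Rightarrow> 'i set" where
  "domains_below S W = {V \<in> domains S. nested S V W}"

definition proj_image :: "('a, 'i, 'c) hhs_structure \<Rightarrow> 'i \<Rightarrow> 'a set \<Rightarrow> 'c set" where
  "proj_image S W A = (\<Union>a\<in>A. proj S W a)"

definition dist_at :: "('a, 'i, 'c) hhs_structure \<Rightarrow> 'i \<Rightarrow> 'a \<Rightarrow> 'a \<Rightarrow> ennreal" where
  "dist_at S W x y = set_dist (hyp_space S W) (proj S W x) (proj S W y)"

definition dist_at_set :: "('a, 'i, 'c) hhs_structure \<Rightarrow> 'i \<Rightarrow> 'a \<Rightarrow> 'c set \<Rightarrow> ennreal" where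
  "dist_at_set S W x p = set_dist (hyp_space S W) (proj S W x) p"

definition hhs_projections :: "'a metric \<Rightarrow> ('a, 'i, 'c) hhs_structure \<Rightarrow> real \<Rightarrow> real \<Rightarrow> bool" where
  "hhs_projections X S \<xi> K \<longleftrightarrow>
     (\<forall>W\<in>domains S.
        (\<forall>x\<in>mspace X. proj S W x \<noteq> {} \<and> proj S W x \<subseteq> mspace (hyp_space S W) \<and>
                       set_diam (hyp_space S W) (proj S W x) \<le> ennreal \<xi>) \<and>
        (\<forall>x\<in>mspace X. \<forall>y\<in>mspace X. dist_at S W x y \<le> ennreal (K * mdist X x y + K)) \<and>
        quasiconvex K (hyp_space S W) (proj_image S W (mspace X)))"

definition hhs_nesting :: "('a, 'i, 'c) hhs_structure \<Rightarrow> real \<Rightarrow> bool" where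
  "hhs_nesting S \<xi> \<longleftrightarrow>
     (\<forall>U\<in>domains S. nested S U U) \<and>
     (\<forall>U\<in>domains S. \<forall>V\<in>domains S. nested S U V \<and> nested S V U \<longrightarrow> U = V) \<and>
     (\<forall>U\<in>domains S. \<forall>V\<in>domains S. \<forall>W\<in>domains S. nested S U V \<and> nested S V W \<longrightarrow> nested S U W) \<and>
     (domains S = {} \<or> (\<exists>!M. M \<in> domains S \<and> (\<forall>W\<in>domains S. nested S M W \<longrightarrow> W = M))) \<and>
     (\<forall>V\<in>domains S. \<forall>W\<in>domains S. pnested S V W \<longrightarrow>
        rho_set S V W \<subseteq> mspace (hyp_space S W) \<and>
        set_diam (hyp_space S W) (rho_set S V W) \<le> ennreal \<xi> \<and>
        (\<forall>p\<in>mspace (hyp_space S W). rho_map S W V p \<subseteq> mspace (hyp_space S V)))"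

definition hhs_orthogonality :: "('a, 'i, 'c) hhs_structure \<Rightarrow> bool" where
  "hhs_orthogonality S \<longleftrightarrow>
     (\<forall>V\<in>domains S. \<forall>W\<in>domains S. orth S V W \<longrightarrow> orth S W V) \<and>
     (\<forall>V\<in>domains S. \<not> orth S V V) \<and>
     (\<forall>V\<in>domains S. \<forall>W\<in>domains S. \<forall>U\<in>domains S. nested S V W \<and> orth S W U \<longrightarrow> orth S V U) \<and>
     (\<forall>T\<in>domains S. \<forall>U\<in>domains_below S T. {V \<in> domains_below S T. orth S V U} \<noteq> {} \<longrightarrow>
        (\<exists>W\<in>domains_below S T - {T}. \<forall>V\<in>domains S. orth S V U \<and> nested S V T \<longrightarrow> nested S V W)) \<and>
     (\<forall>V\<in>domains S. \<forall>W\<in>domains S. orth S V W \<longrightarrow> \<not> nested S V W \<and> \<not> nested S W V)"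

text \<open>
  The last clause, taken with \<open>U = V\<close>, forces \<open>rho_set V W\<close> to be nonempty whenever \<open>V\<close> is properly
  nested in or transverse to \<open>W\<close>, since distances to the empty set are infinite.
\<close>

definition hhs_consistency ::
    "'a metric \<Rightarrow> ('a, 'i, 'c) hhs_structure \<Rightarrow> real \<Rightarrow> real \<Rightarrow> bool" where
  "hhs_consistency X S \<xi> \<kappa>0 \<longleftrightarrow>
     (\<forall>V\<in>domains S. \<forall>W\<in>domains S. transverse S V W \<longrightarrow>
        rho_set S V W \<subseteq> mspace (hyp_space S W) \<and>
        set_diam (hyp_space S W) (rho_set S V W) \<le> ennreal \<xi> \<and>
        rho_set S W V \<subseteq> mspace (hyp_space S V) \<and>
        set_diam (hyp_space S V) (rho_set S W V) \<le> ennreal \<xi> \<and>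
        (\<forall>x\<in>mspace X.
           min (dist_at_set S W x (rho_set S V W)) (dist_at_set S V x (rho_set S W V)) \<le> ennreal \<kappa>0)) \<and>
     (\<forall>V\<in>domains S. \<forall>W\<in>domains S. pnested S V W \<longrightarrow>
        (\<forall>x\<in>mspace X.
           min (dist_at_set S W x (rho_set S V W))
               (set_diam (hyp_space S V) (proj S V x \<union> (\<Union>p\<in>proj S W x. rho_map S W V p)))
             \<le> ennreal \<kappa>0)) \<and>
     (\<forall>U\<in>domains S. \<forall>V\<in>domains S. \<forall>W\<in>domains S.
        nested S U V \<and> (pnested S V W \<or> (transverse S V W \<and> \<not> orth S W U)) \<longrightarrow>
        set_dist (hyp_space S W) (rho_set S U W) (rho_set S V W) \<le> ennreal \<kappa>0)"

definition hhs_complexity :: "('a, 'i, 'c) hhs_structure \<Rightarrow> nat \<Rightarrow> bool" where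
  "hhs_complexity S n \<longleftrightarrow>
     (\<forall>\<C>\<subseteq>domains S. (\<forall>V\<in>\<C>. \<forall>W\<in>\<C>. nested S V W \<or> nested S W V) \<longrightarrow> finite \<C> \<and> card \<C> \<le> n)"

definition hhs_large_links ::
    "'a metric \<Rightarrow> ('a, 'i, 'c) hhs_structure \<Rightarrow> real \<Rightarrow> real \<Rightarrow> bool" where
  "hhs_large_links X S lam E \<longleftrightarrow>
     (\<forall>W\<in>domains S. \<forall>x\<in>mspace X. \<forall>x'\<in>mspace X.
        let N = lam * enn2real (dist_at S W x x') + lam in
        \<exists>\<T> \<subseteq> domains_below S W - {W}.
          finite \<T> \<and> int (card \<T>) \<le> \<lfloor>N\<rfloor> \<and>
          (\<forall>T\<in>domains_below S W - {W}.
             (\<exists>T'\<in>\<T>. T \<in> domains_below S T') \<or> dist_at S T x x' < ennreal E) \<and>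
          (\<forall>T'\<in>\<T>. dist_at_set S W x (rho_set S T' W) \<le> ennreal N))"

definition hhs_bounded_geodesic_image :: "('a, 'i, 'c) hhs_structure \<Rightarrow> real \<Rightarrow> bool" where
  "hhs_bounded_geodesic_image S E \<longleftrightarrow>
     (\<forall>V\<in>domains S. \<forall>W\<in>domains S. pnested S V W \<longrightarrow>
        (\<forall>x y P. geodesic_segment (hyp_space S W) x y P \<longrightarrow>
           set_diam (hyp_space S V) (\<Union>p\<in>P. rho_map S W V p) \<le> ennreal E \<or>
           (\<exists>p\<in>P. set_dist (hyp_space S W) {p} (rho_set S V W) \<le> ennreal E)))"

text \<open>
  Families of pairwise orthogonal elements may be taken to be sets, as orthogonality is
  anti-reflexive. The empty family is allowed, so a hierarchically hyperbolic space is nonempty.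
\<close>

definition hhs_partial_realization :: "'a metric \<Rightarrow> ('a, 'i, 'c) hhs_structure \<Rightarrow> real \<Rightarrow> bool" where
  "hhs_partial_realization X S \<alpha> \<longleftrightarrow>
     (\<forall>\<V>\<subseteq>domains S. \<forall>p.
        (\<forall>V\<in>\<V>. \<forall>V'\<in>\<V>. V \<noteq> V' \<longrightarrow> orth S V V') \<and> (\<forall>V\<in>\<V>. p V \<in> proj_image S V (mspace X)) \<longrightarrow>
        (\<exists>x\<in>mspace X.
           (\<forall>V\<in>\<V>. dist_at_set S V x {p V} \<le> ennreal \<alpha>) \<and>
           (\<forall>V\<in>\<V>. \<forall>W\<in>domains S. pnested S V W \<or> transverse S W V \<longrightarrow>
              dist_at_set S W x (rho_set S V W) \<le> ennreal \<alpha>)))"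

definition hhs_uniqueness :: "'a metric \<Rightarrow> ('a, 'i, 'c) hhs_structure \<Rightarrow> bool" where
  "hhs_uniqueness X S \<longleftrightarrow>
     (\<forall>\<kappa>\<ge>0. \<exists>\<theta>. \<forall>x\<in>mspace X. \<forall>y\<in>mspace X.
        mdist X x y \<ge> \<theta> \<longrightarrow> (\<exists>V\<in>domains S. dist_at S V x y \<ge> ennreal \<kappa>))"

definition hierarchically_hyperbolic :: "'a metric \<Rightarrow> ('a, 'i, 'c) hhs_structure \<Rightarrow> bool" where
  "hierarchically_hyperbolic X S \<longleftrightarrow>
     (\<exists>q\<ge>1. quasigeodesic_space q X) \<and>
     (\<exists>\<delta>\<ge>0. \<forall>W\<in>domains S. geodesic_space (hyp_space S W) \<and> hyperbolic \<delta> (hyp_space S W)) \<and>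
     (\<exists>\<xi>\<ge>0. \<exists>K\<ge>0. \<exists>\<kappa>0\<ge>0. \<exists>lam\<ge>1. \<exists>E\<ge>max \<xi> \<kappa>0.
        hhs_projections X S \<xi> K \<and> hhs_nesting S \<xi> \<and> hhs_consistency X S \<xi> \<kappa>0 \<and>
        hhs_large_links X S lam E) \<and>
     hhs_orthogonality S \<and>
     (\<exists>n. hhs_complexity S n) \<and>
     (\<exists>E>0. hhs_bounded_geodesic_image S E) \<and>
     (\<exists>\<alpha>\<ge>0. hhs_partial_realization X S \<alpha>) \<and>
     hhs_uniqueness X S"


section \<open>Hieromorphisms and hierarchical quasiconvexity\<close>

text \<open>
  The coarse map \<open>\<rho>\<^sup>U\<^sub>V\<close> from the space of \<open>U\<close> to that of \<open>V\<close>, for distinct non-orthogonal \<open>U\<close> and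
  \<open>V\<close>; it is constant unless \<open>V\<close> is properly nested in \<open>U\<close>.
\<close>

definition rho_coarse :: "('a, 'i, 'c) hhs_structure \<Rightarrow> 'i \<Rightarrow> 'i \<Rightarrow> 'c \<Rightarrow> 'c set" where
  "rho_coarse S U V p = (if pnested S V U then rho_map S U V p else rho_set S U V)"

definition hieromorphism ::
    "'a metric \<Rightarrow> ('a, 'i, 'c) hhs_structure \<Rightarrow> 'b metric \<Rightarrow> ('b, 'j, 'd) hhs_structure \<Rightarrow>
     ('a \<Rightarrow> 'b) \<Rightarrow> ('i \<Rightarrow> 'j) \<Rightarrow> ('i \<Rightarrow> 'c \<Rightarrow> 'd) \<Rightarrow> bool" where
  "hieromorphism X S X' S' f f_dom f_hyp \<longleftrightarrow>
     f ` mspace X \<subseteq> mspace X' \<and>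
     f_dom ` domains S \<subseteq> domains S' \<and> inj_on f_dom (domains S) \<and>
     (\<forall>U\<in>domains S. \<forall>V\<in>domains S.
        (nested S U V \<longrightarrow> nested S' (f_dom U) (f_dom V)) \<and>
        (transverse S U V \<longrightarrow> transverse S' (f_dom U) (f_dom V)) \<and>
        (orth S U V \<longrightarrow> orth S' (f_dom U) (f_dom V))) \<and>
     (\<exists>q\<ge>1. \<forall>U\<in>domains S. qi_embedding q (hyp_space S U) (hyp_space S' (f_dom U)) (f_hyp U)) \<and>
     (\<exists>r\<ge>0. \<forall>U\<in>domains S. \<forall>x\<in>mspace X.
        coarsely_equal (hyp_space S' (f_dom U)) r (proj S' (f_dom U) (f x)) (f_hyp U ` proj S U x)) \<and>
     (\<exists>r\<ge>0. \<forall>U\<in>domains S. \<forall>V\<in>domains S. U \<noteq> V \<and> \<not> orth S U V \<longrightarrow>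
        (\<forall>p\<in>mspace (hyp_space S U).
           coarsely_equal (hyp_space S' (f_dom V)) r
             (f_hyp V ` rho_coarse S U V p) (rho_coarse S' (f_dom U) (f_dom V) (f_hyp U p))))"

definition hierarchically_quasiconvex ::
    "'a metric \<Rightarrow> ('a, 'i, 'c) hhs_structure \<Rightarrow> (real \<Rightarrow> real) \<Rightarrow> 'a set \<Rightarrow> bool" where
  "hierarchically_quasiconvex X S k Y \<longleftrightarrow>
     Y \<subseteq> mspace X \<and>
     (\<forall>t\<ge>0. k t \<ge> 0) \<and>
     (\<forall>U\<in>domains S. quasiconvex (k 0) (hyp_space S U) (proj_image S U Y)) \<and>
     (\<forall>\<kappa>>0. \<forall>x\<in>mspace X.
        (\<forall>U\<in>domains S. dist_at_set S U x (proj_image S U Y) \<le> ennreal \<kappa>) \<longrightarrow>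
        set_dist X {x} Y \<le> ennreal (k \<kappa>))"

definition quasiconvex_hieromorphism ::
    "'a metric \<Rightarrow> ('a, 'i, 'c) hhs_structure \<Rightarrow> 'b metric \<Rightarrow> ('b, 'j, 'd) hhs_structure \<Rightarrow>
     ('a \<Rightarrow> 'b) \<Rightarrow> ('i \<Rightarrow> 'j) \<Rightarrow> ('i \<Rightarrow> 'c \<Rightarrow> 'd) \<Rightarrow> bool" where
  "quasiconvex_hieromorphism X S X' S' f f_dom f_hyp \<longleftrightarrow>
     hieromorphism X S X' S' f f_dom f_hyp \<and>
     (\<exists>q\<ge>1. qi_embedding q X X' f) \<and>
     (\<exists>k. hierarchically_quasiconvex X' S' k (f ` mspace X))"

end

theory Submission
  imports Defs
begin

text \<open>
  Adjoin a trivial domain to each of the two index sets and take as domains of the product all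
  pairs of (possibly trivial) domains that are not both trivial, with componentwise nesting and
  orthogonality. Pairs with one trivial component carry the hyperbolic space of the other one, so
  that each axiom for them reduces to the same axiom for a factor. Pairs with two nontrivial
  components carry a point, so the axioms hold trivially for them, except that large links needs
  the two domains \<open>(U, None)\<close> and \<open>(None, V)\<close> below \<open>(U, V)\<close>. They are present because the
  orthogonality axiom asks for proper containers: if \<open>W\<close> contains the domains of the first factor
  orthogonal to \<open>U\<close>, then \<open>(W, N)\<close>, with \<open>N\<close> the largest domain of the second factor,
  contains all those orthogonal to \<open>(U, None)\<close>.
\<close>

section \<open>Transport of metric notions along injections\<close>

text \<open>A structure has a single type for the points of all its hyperbolic spaces, so those of
  the two factors are copied into \<open>'c + 'd\<close> along \<open>Inl\<close> and
  \<open>Inr\<close>; the copies keep all distances, and the inclusions of the factors respect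
  projections and relative projections without error. Making the trivial domain orthogonal to
  everything makes the domains of the two factors orthogonal to each other, so that a pairwise
  orthogonal family can be realized one coordinate at a time. The price is a kind of transversality
  that no factor has: if \<open>V\<close> is properly nested in \<open>W\<close> and
  \<open>B\<close> is nontrivial, then \<open>(Some V, B)\<close> is transverse to
  \<open>(Some W, None)\<close>. The set \<rho> given by the nesting in the factor is used there,
  and the consistency inequality holds because \<open>(Some V, B)\<close> carries a point.
  Hierarchical quasiconvexity of a factor rests on uniqueness in the other one: the domains of the
  other factor see only the basepoint, so a point close to the slice in all of them has its other
  coordinate close to the basepoint.\<close>

definition image_metric :: "('a \<Rightarrow> 'b) \<Rightarrow> 'a metric \<Rightarrow> 'b metric" where
  "image_metric f m = metric (f ` mspace m, \<lambda>x y. mdist m (inv f x) (inv f y))"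

definition point_metric :: "'a \<Rightarrow> 'a metric" where
  "point_metric p = metric ({p}, \<lambda>_ _. 0)"

lemma Metric_space_image:
  assumes "inj f"
  shows "Metric_space (f ` mspace m) (\<lambda>x y. mdist m (inv f x) (inv f y))"
proof
  fix x y z
  show "0 \<le> mdist m (inv f x) (inv f y)" by simp
  show "mdist m (inv f x) (inv f y) = mdist m (inv f y) (inv f x)" by (rule mdist_commute)
  show "(mdist m (inv f x) (inv f y) = 0) = (x = y)" if "x \<in> f ` mspace m" "y \<in> f ` mspace m"
    using that assms by (auto simp: inj_eq)
  show "mdist m (inv f x) (inv f z) \<le> mdist m (inv f x) (inv f y) + mdist m (inv f y) (inv f z)"
    if "x \<in> f ` mspace m" "y \<in> f ` mspace m" "z \<in> f ` mspace m"
    using that assms by (auto intro: mdist_triangle)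
qed

lemma mspace_image_metric [simp]: "inj f \<Longrightarrow> mspace (image_metric f m) = f ` mspace m"
  unfolding image_metric_def by (rule Metric_space.mspace_metric[OF Metric_space_image])

lemma mdist_image_metric [simp]: "inj f \<Longrightarrow> mdist (image_metric f m) (f x) (f y) = mdist m x y"
  unfolding image_metric_def by (simp add: Metric_space.mdist_metric[OF Metric_space_image])

lemma mdist_self [simp]: "x \<in> mspace m \<Longrightarrow> mdist m x x = 0"
  by simp

lemma Metric_space_point: "Metric_space {p} (\<lambda>_ _. 0)"
  by unfold_locales auto

lemma mspace_point_metric [simp]: "mspace (point_metric p) = {p}"
  unfolding point_metric_def by (rule Metric_space.mspace_metric[OF Metric_space_point])

lemma mdist_point_metric [simp]: "mdist (point_metric p) x y = 0"
  unfolding point_metric_def by (simp add: Metric_space.mdist_metric[OF Metric_space_point])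

lemma set_dist_image [simp]:
  "inj f \<Longrightarrow> set_dist (image_metric f m) (f ` A) (f ` B) = set_dist m A B"
  by (simp add: set_dist_def image_image)

lemma set_dist_image_singleton_left [simp]:
  "inj f \<Longrightarrow> set_dist (image_metric f m) {f x} (f ` B) = set_dist m {x} B"
  using set_dist_image[of f m "{x}" B] by simp

lemma set_dist_image_singleton_right [simp]:
  "inj f \<Longrightarrow> set_dist (image_metric f m) (f ` A) {f y} = set_dist m A {y}"
  using set_dist_image[of f m A "{y}"] by simp

lemma set_diam_image [simp]: "inj f \<Longrightarrow> set_diam (image_metric f m) (f ` A) = set_diam m A"
  by (simp add: set_diam_def image_image)

lemma set_dist_point [simp]: "set_dist (point_metric p) {x} {y} = 0"
  by (simp add: set_dist_def)

lemma set_diam_point [simp]: "set_diam (point_metric p) A = 0"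
  by (cases "A = {}") (simp_all add: set_diam_def bot_ennreal)

lemma set_dist_le: "a \<in> A \<Longrightarrow> b \<in> B \<Longrightarrow> set_dist m A B \<le> ennreal (mdist m a b)"
  unfolding set_dist_def by (meson INF_lower2 order_refl)

lemma mdist_le_set_diam: "a \<in> A \<Longrightarrow> b \<in> A \<Longrightarrow> ennreal (mdist m a b) \<le> set_diam m A"
  unfolding set_diam_def by (meson SUP_upper2 order_refl)

lemma coarsely_equal_refl: "A \<subseteq> mspace m \<Longrightarrow> coarsely_equal m r A A"
  unfolding coarsely_equal_def by (metis ennreal_0 mdist_zero set_dist_le singletonI subsetD
      order_trans zero_le)

section \<open>Geodesics, hyperbolicity and quasiconvexity\<close>

lemma geodesic_segment_subset: "geodesic_segment m x y P \<Longrightarrow> P \<subseteq> mspace m"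
  by (auto simp: geodesic_segment_def)

lemma geodesic_segment_endpoints:
  assumes "geodesic_segment m x y P"
  shows "x \<in> P" "y \<in> P"
  using assms by (auto simp: geodesic_segment_def)

text \<open>In the arc length parametrization starting at \<open>x\<close>, the point at time
  \<open>t\<close> has distance \<open>t\<close> from \<open>x\<close>, and \<open>t\<close> is at
  most the length, which is the distance of the endpoints.\<close>

lemma geodesic_segment_mdist_le:
  assumes "geodesic_segment m x y P" "p \<in> P"
  shows "mdist m p x \<le> mdist m x y"
proof -
  obtain L \<gamma> where L: "L \<ge> 0"
    and \<gamma>: "\<And>s t. s \<in> {0..L} \<Longrightarrow> t \<in> {0..L} \<Longrightarrow> mdist m (\<gamma> s) (\<gamma> t) = \<bar>s - t\<bar>"
    and ends: "\<gamma> 0 = x" "\<gamma> L = y" "P = \<gamma> ` {0..L}"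
    using assms(1) unfolding geodesic_segment_def by blast
  obtain t where t: "t \<in> {0..L}" "p = \<gamma> t"
    using assms(2) ends by blast
  have "mdist m p x = t" "mdist m x y = L"
    using \<gamma>[of t 0] \<gamma>[of 0 L] t L ends by auto
  then show ?thesis using t by simp
qed

text \<open>Paths are composed with \<open>f\<close> in one direction and with \<open>inv f\<close>
  in the other. The latter is legitimate because a geodesic stays in the carrier of the image
  metric, so that \<open>f\<close> undoes \<open>inv f\<close> along it.\<close>

lemma geodesic_segment_image [simp]:
  assumes "inj f"
  shows "geodesic_segment (image_metric f m) (f x) (f y) (f ` P) \<longleftrightarrow> geodesic_segment m x y P"
proof
  assume "geodesic_segment m x y P"
  then obtain L \<gamma> where "L \<ge> 0" "\<gamma> ` {0..L} \<subseteq> mspace m"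
    "\<forall>s\<in>{0..L}. \<forall>t\<in>{0..L}. mdist m (\<gamma> s) (\<gamma> t) = \<bar>s - t\<bar>"
    "\<gamma> 0 = x" "\<gamma> L = y" "P = \<gamma> ` {0..L}"
    unfolding geodesic_segment_def by blast
  then show "geodesic_segment (image_metric f m) (f x) (f y) (f ` P)"
    unfolding geodesic_segment_def using assms
    by (intro exI[of _ L] exI[of _ "f \<circ> \<gamma>"] conjI) (auto simp: image_comp)
next
  assume "geodesic_segment (image_metric f m) (f x) (f y) (f ` P)"
  then obtain L \<gamma> where L: "L \<ge> 0" "\<gamma> ` {0..L} \<subseteq> f ` mspace m"
    and d: "\<forall>s\<in>{0..L}. \<forall>t\<in>{0..L}. mdist (image_metric f m) (\<gamma> s) (\<gamma> t) = \<bar>s - t\<bar>"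
    and e: "\<gamma> 0 = f x" "\<gamma> L = f y" "f ` P = \<gamma> ` {0..L}"
    unfolding geodesic_segment_def using assms by auto
  have f: "f (inv f (\<gamma> t)) = \<gamma> t" if "t \<in> {0..L}" for t
    using L(2) that by (intro f_inv_into_f) blast
  have "P = inv f ` f ` P" using assms by (simp add: image_image)
  also have "\<dots> = (inv f \<circ> \<gamma>) ` {0..L}" using e by (simp add: image_comp)
  finally have P: "P = (inv f \<circ> \<gamma>) ` {0..L}" .
  have "mdist m (inv f (\<gamma> s)) (inv f (\<gamma> t)) = \<bar>s - t\<bar>" if "s \<in> {0..L}" "t \<in> {0..L}" for s t
    using d that f mdist_image_metric[OF assms, of m "inv f (\<gamma> s)" "inv f (\<gamma> t)"] by simp
  moreover have "(inv f \<circ> \<gamma>) ` {0..L} \<subseteq> mspace m"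
    using L(2) assms by (force simp: image_subset_iff)
  ultimately show "geodesic_segment m x y P"
    unfolding geodesic_segment_def using L e assms P
    by (intro exI[of _ L] exI[of _ "inv f \<circ> \<gamma>"] conjI) auto
qed

text \<open>A geodesic lies in the carrier and contains its endpoints, hence all of its data have
  preimages. Conditions on all geodesics of a copy are pulled back to the original space in this
  way.\<close>

lemma geodesic_segment_imageE:
  assumes "inj f" "geodesic_segment (image_metric f m) x y P"
  obtains x' y' P' where "x = f x'" "y = f y'" "P = f ` P'" "geodesic_segment m x' y' P'"
proof -
  have P: "P \<subseteq> f ` mspace m"
    using geodesic_segment_subset[OF assms(2)] assms(1) by simp
  then obtain P' where P': "P = f ` P'" by (meson subset_imageE)
  moreover obtain x' y' where "x = f x'" "y = f y'"
    using geodesic_segment_endpoints[OF assms(2)] P by blast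
  ultimately show thesis
    using that assms by simp
qed

lemma geodesic_space_image: "inj f \<Longrightarrow> geodesic_space m \<Longrightarrow> geodesic_space (image_metric f m)"
  unfolding geodesic_space_def by simp (metis geodesic_segment_image)

lemma hyperbolic_image:
  assumes f: "inj f" and "hyperbolic \<delta> m"
  shows "hyperbolic \<delta> (image_metric f m)"
  unfolding hyperbolic_def
proof (intro allI impI ballI, elim conjE)
  fix x y z P Q R p
  assume g: "geodesic_segment (image_metric f m) x y P" "geodesic_segment (image_metric f m) y z Q"
    "geodesic_segment (image_metric f m) z x R" and p: "p \<in> P"
  obtain x' y' P' where 1: "x = f x'" "y = f y'" "P = f ` P'" "geodesic_segment m x' y' P'"
    using geodesic_segment_imageE[OF f g(1)] .
  obtain y'' z' Q' where 2: "y = f y''" "z = f z'" "Q = f ` Q'" "geodesic_segment m y'' z' Q'"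
    using geodesic_segment_imageE[OF f g(2)] .
  obtain z'' x'' R' where 3: "z = f z''" "x = f x''" "R = f ` R'" "geodesic_segment m z'' x'' R'"
    using geodesic_segment_imageE[OF f g(3)] .
  \<comment> \<open>The three sides were pulled back separately; injectivity of \<open>f\<close>
    makes their preimages close up to a triangle.\<close>
  have "x'' = x'" "y'' = y'" "z'' = z'"
    using 1 2 3 f by (auto dest: injD)
  moreover obtain p' where "p = f p'" "p' \<in> P'" using p 1 by blast
  ultimately have "set_dist m {p'} (Q' \<union> R') \<le> ennreal \<delta>"
    using assms(2) 1 2 3 unfolding hyperbolic_def by blast
  then show "set_dist (image_metric f m) {p} (Q \<union> R) \<le> ennreal \<delta>"
    using f \<open>p = f p'\<close> 2 3 by (simp flip: image_Un)
qed

lemma quasiconvex_image: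
  assumes f: "inj f" and "quasiconvex k m A"
  shows "quasiconvex k (image_metric f m) (f ` A)"
  unfolding quasiconvex_def
proof (intro conjI ballI allI impI)
  show "f ` A \<subseteq> mspace (image_metric f m)"
    using assms by (auto simp: quasiconvex_def)
  fix x y P p
  assume xy: "x \<in> f ` A" "y \<in> f ` A" and g: "geodesic_segment (image_metric f m) x y P"
    and p: "p \<in> P"
  obtain x' y' P' where 1: "x = f x'" "y = f y'" "P = f ` P'" "geodesic_segment m x' y' P'"
    using geodesic_segment_imageE[OF f g] .
  then have "x' \<in> A" "y' \<in> A" using xy f by (auto dest: injD)
  moreover obtain p' where "p = f p'" "p' \<in> P'" using p 1 by blast
  ultimately show "set_dist (image_metric f m) {p} (f ` A) \<le> ennreal k"
    using assms(2) 1 f unfolding quasiconvex_def by simp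
qed

text \<open>Points of a geodesic are no farther from its start than its end is, and both ends lie in
  \<open>A\<close>. Applied to the projection of a single basepoint, this gives quasiconvexity with
  the constant that bounds the diameters of projections.\<close>

lemma quasiconvex_bounded:
  assumes "A \<subseteq> mspace m" "set_diam m A \<le> ennreal k"
  shows "quasiconvex k m A"
  unfolding quasiconvex_def
proof (intro conjI ballI allI impI assms(1))
  fix x y P p assume xy: "x \<in> A" "y \<in> A" and g: "geodesic_segment m x y P" "p \<in> P"
  have "set_dist m {p} A \<le> ennreal (mdist m p x)" using xy by (intro set_dist_le) auto
  also have "\<dots> \<le> ennreal (mdist m x y)"
    using geodesic_segment_mdist_le[OF g] by (rule ennreal_leI)
  also have "\<dots> \<le> set_diam m A" using xy by (rule mdist_le_set_diam)
  finally show "set_dist m {p} A \<le> ennreal k" using assms(2) by (rule order_trans)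
qed

lemma quasiconvex_point: "A \<subseteq> {p} \<Longrightarrow> quasiconvex k (point_metric p) A"
  by (rule quasiconvex_bounded) auto

lemma geodesic_space_point: "geodesic_space (point_metric p)"
  unfolding geodesic_space_def geodesic_segment_def
  by (auto intro!: exI[of _ "0::real"] exI[of _ "\<lambda>_. p"])

lemma hyperbolic_point: "hyperbolic \<delta> (point_metric p)"
  unfolding hyperbolic_def
proof (intro allI impI ballI, elim conjE)
  fix x y z P Q R q
  assume "geodesic_segment (point_metric p) y z Q"
  then have "y \<in> Q" by (rule geodesic_segment_endpoints)
  then show "set_dist (point_metric p) {q} (Q \<union> R) \<le> ennreal \<delta>"
    using set_dist_le[of q "{q}" y "Q \<union> R" "point_metric p"] by simp
qed

lemma hyperbolic_mono: "hyperbolic \<delta> m \<Longrightarrow> \<delta> \<le> \<delta>' \<Longrightarrow> hyperbolic \<delta>' m"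
  unfolding hyperbolic_def by (meson ennreal_leI order_trans)

lemma quasiconvex_mono: "quasiconvex k m A \<Longrightarrow> k \<le> k' \<Longrightarrow> quasiconvex k' m A"
  unfolding quasiconvex_def by (meson ennreal_leI order_trans)

text \<open>The two quasigeodesics are traversed one after the other. Elapsed times and l1 distances
  both split as sums over the coordinates, so the two pairs of inequalities add up; the additive
  errors add as well, hence the constant \<open>q0 + q1\<close>.\<close>

lemma quasigeodesic_space_l1_prod:
  assumes q: "q0 \<ge> 1" "q1 \<ge> 1"
    and "quasigeodesic_space q0 X0" "quasigeodesic_space q1 X1"
  shows "quasigeodesic_space (q0 + q1) (l1_prod_metric X0 X1)"
  unfolding quasigeodesic_space_def
proof (intro ballI)
  fix x y assume xy: "x \<in> mspace (l1_prod_metric X0 X1)" "y \<in> mspace (l1_prod_metric X0 X1)"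
  obtain x0 x1 y0 y1 where [simp]: "x = (x0, x1)" "y = (y0, y1)" by (metis surj_pair)
  obtain L0 \<gamma>0 where L0: "L0 \<ge> 0" and e0: "\<gamma>0 0 = x0" "\<gamma>0 L0 = y0"
    and \<gamma>0: "qi_embedding q0 (submetric euclidean_metric {0..L0::real}) X0 \<gamma>0"
    using assms(3) xy unfolding quasigeodesic_space_def by simp metis
  obtain L1 \<gamma>1 where L1: "L1 \<ge> 0" and e1: "\<gamma>1 0 = x1" "\<gamma>1 L1 = y1"
    and \<gamma>1: "qi_embedding q1 (submetric euclidean_metric {0..L1::real}) X1 \<gamma>1"
    using assms(4) xy unfolding quasigeodesic_space_def by simp metis
  \<comment> \<open>Internal clocks of the two coordinates: \<open>l\<close> stops at
    \<open>L0\<close>, which is when \<open>r\<close> starts running from 0, so that together the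
    clocks advance as much as \<open>t\<close>.\<close>
  define l r where "l t = min t L0" and "r t = max 0 (t - L0)" for t
  define \<gamma> where "\<gamma> t = (\<gamma>0 (l t), \<gamma>1 (r t))" for t
  have lr: "l t \<in> {0..L0}" "r t \<in> {0..L1}" if "t \<in> {0..L0+L1}" for t
    using that L0 L1 by (auto simp: l_def r_def)
  have split: "\<bar>s - t\<bar> = \<bar>l s - l t\<bar> + \<bar>r s - r t\<bar>" for s t
    by (auto simp: l_def r_def min_def max_def)
  have bounds: "\<bar>s - t\<bar> / (q0 + q1) - (q0 + q1) \<le> mdist X0 (\<gamma>0 (l s)) (\<gamma>0 (l t)) + mdist X1 (\<gamma>1 (r s)) (\<gamma>1 (r t))"
    "mdist X0 (\<gamma>0 (l s)) (\<gamma>0 (l t)) + mdist X1 (\<gamma>1 (r s)) (\<gamma>1 (r t)) \<le> (q0 + q1) * \<bar>s - t\<bar> + (q0 + q1)"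
    if st: "s \<in> {0..L0+L1}" "t \<in> {0..L0+L1}" for s t
  proof -
    have b0: "\<bar>l s - l t\<bar> / q0 - q0 \<le> mdist X0 (\<gamma>0 (l s)) (\<gamma>0 (l t))"
      "mdist X0 (\<gamma>0 (l s)) (\<gamma>0 (l t)) \<le> q0 * \<bar>l s - l t\<bar> + q0"
      using \<gamma>0 lr[OF st(1)] lr[OF st(2)] unfolding qi_embedding_def
      by (auto simp: dist_real_def)
    have b1: "\<bar>r s - r t\<bar> / q1 - q1 \<le> mdist X1 (\<gamma>1 (r s)) (\<gamma>1 (r t))"
      "mdist X1 (\<gamma>1 (r s)) (\<gamma>1 (r t)) \<le> q1 * \<bar>r s - r t\<bar> + q1"
      using \<gamma>1 lr[OF st(1)] lr[OF st(2)] unfolding qi_embedding_def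
      by (auto simp: dist_real_def)
    \<comment> \<open>Enlarging the denominators \<open>q0\<close> and \<open>q1\<close> to their
      sum does not increase the two quotients.\<close>
    have "\<bar>s - t\<bar> / (q0 + q1) \<le> \<bar>l s - l t\<bar> / q0 + \<bar>r s - r t\<bar> / q1"
      unfolding split[of s t] add_divide_distrib using q
      by (intro add_mono divide_left_mono) auto
    then show "\<bar>s - t\<bar> / (q0 + q1) - (q0 + q1) \<le> mdist X0 (\<gamma>0 (l s)) (\<gamma>0 (l t)) + mdist X1 (\<gamma>1 (r s)) (\<gamma>1 (r t))"
      using b0 b1 by linarith
    have "q0 * \<bar>l s - l t\<bar> + q1 * \<bar>r s - r t\<bar> \<le> (q0 + q1) * \<bar>s - t\<bar>"
      unfolding split[of s t] distrib_left using q by (intro add_mono mult_right_mono) auto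
    then show "mdist X0 (\<gamma>0 (l s)) (\<gamma>0 (l t)) + mdist X1 (\<gamma>1 (r s)) (\<gamma>1 (r t)) \<le> (q0 + q1) * \<bar>s - t\<bar> + (q0 + q1)"
      using b0 b1 by linarith
  qed
  have "\<gamma> t \<in> mspace (l1_prod_metric X0 X1)" if "t \<in> {0..L0+L1}" for t
    using lr[OF that] \<gamma>0 \<gamma>1 unfolding qi_embedding_def \<gamma>_def by auto
  with bounds have "qi_embedding (q0 + q1) (submetric euclidean_metric {0..L0+L1}) (l1_prod_metric X0 X1) \<gamma>"
    unfolding qi_embedding_def by (auto simp: \<gamma>_def dist_real_def)
  moreover have "\<gamma> 0 = x" "\<gamma> (L0 + L1) = y"
    using L0 L1 e0 e1 by (auto simp: \<gamma>_def l_def r_def)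
  ultimately show "\<exists>L\<ge>0. \<exists>\<gamma>. qi_embedding (q0 + q1) (submetric euclidean_metric {0..L::real})
      (l1_prod_metric X0 X1) \<gamma> \<and> \<gamma> 0 = x \<and> \<gamma> L = y"
    using L0 L1 by (metis add_nonneg_nonneg)
qed


section \<open>Weakening the constants of a hierarchically hyperbolic structure\<close>

text \<open>The factors come with unrelated constants, while the product needs one set of constants
  for the domains of both. The constants only enter as upper bounds, so they can be raised to common
  values.\<close>

lemma hhs_projections_mono:
  assumes "hhs_projections X S \<xi> K" "\<xi> \<le> \<xi>'" "K \<le> K'"
  shows "hhs_projections X S \<xi>' K'"
proof -
  have "ennreal (K * mdist X x y + K) \<le> ennreal (K' * mdist X x y + K')" for x y
    using assms(3) by (intro ennreal_leI add_mono mult_right_mono) auto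
  then show ?thesis
    using assms unfolding hhs_projections_def
    by (meson ennreal_leI order_trans quasiconvex_mono)
qed

lemma hhs_nesting_mono: "hhs_nesting S \<xi> \<Longrightarrow> \<xi> \<le> \<xi>' \<Longrightarrow> hhs_nesting S \<xi>'"
  unfolding hhs_nesting_def by (elim conjE, intro conjI) (assumption | meson ennreal_leI order_trans)+

lemma hhs_consistency_mono:
  assumes "hhs_consistency X S \<xi> \<kappa>" "\<xi> \<le> \<xi>'" "\<kappa> \<le> \<kappa>'"
  shows "hhs_consistency X S \<xi>' \<kappa>'"
proof -
  have *: "\<And>a. a \<le> ennreal \<xi> \<Longrightarrow> a \<le> ennreal \<xi>'" "\<And>a. a \<le> ennreal \<kappa> \<Longrightarrow> a \<le> ennreal \<kappa>'"
    using assms(2,3) by (auto intro: order_trans ennreal_leI)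
  show ?thesis
    using assms(1) unfolding hhs_consistency_def
    by (elim conjE, intro conjI ballI impI) (blast intro: *)+
qed

lemma hhs_large_links_mono:
  assumes "hhs_large_links X S lam E" "lam \<le> lam'" "E \<le> E'"
  shows "hhs_large_links X S lam' E'"
  unfolding hhs_large_links_def Let_def
proof (intro ballI)
  fix W x x' assume W: "W \<in> domains S" "x \<in> mspace X" "x' \<in> mspace X"
  let ?N = "\<lambda>l. l * enn2real (dist_at S W x x') + l"
  obtain \<T> where \<T>: "\<T> \<subseteq> domains_below S W - {W}" "finite \<T>" "int (card \<T>) \<le> \<lfloor>?N lam\<rfloor>"
    "\<forall>T\<in>domains_below S W - {W}. (\<exists>T'\<in>\<T>. T \<in> domains_below S T') \<or> dist_at S T x x' < ennreal E"
    "\<forall>T'\<in>\<T>. dist_at_set S W x (rho_set S T' W) \<le> ennreal (?N lam)"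
    using assms(1)[unfolded hhs_large_links_def Let_def, THEN bspec, THEN bspec, THEN bspec, OF W] by blast
  have N: "?N lam \<le> ?N lam'"
    using assms(2) by (intro add_mono mult_right_mono) auto
  show "\<exists>\<T>\<subseteq>domains_below S W - {W}. finite \<T> \<and> int (card \<T>) \<le> \<lfloor>?N lam'\<rfloor> \<and>
      (\<forall>T\<in>domains_below S W - {W}. (\<exists>T'\<in>\<T>. T \<in> domains_below S T') \<or> dist_at S T x x' < ennreal E') \<and>
      (\<forall>T'\<in>\<T>. dist_at_set S W x (rho_set S T' W) \<le> ennreal (?N lam'))"
    using \<T> floor_mono[OF N] ennreal_leI[OF N] ennreal_leI[OF assms(3)]
    by (intro exI[of _ \<T>] conjI) (auto intro: order_trans order_less_le_trans)
qed

lemma hhs_bounded_geodesic_image_mono: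
  "hhs_bounded_geodesic_image S E \<Longrightarrow> E \<le> E' \<Longrightarrow> hhs_bounded_geodesic_image S E'"
  unfolding hhs_bounded_geodesic_image_def by (meson ennreal_leI order_trans)

lemma hhs_partial_realization_mono:
  assumes "hhs_partial_realization X S \<alpha>" "\<alpha> \<le> \<alpha>'"
  shows "hhs_partial_realization X S \<alpha>'"
  unfolding hhs_partial_realization_def
proof (intro allI impI)
  fix \<V> p
  assume "\<V> \<subseteq> domains S"
    and "(\<forall>V\<in>\<V>. \<forall>V'\<in>\<V>. V \<noteq> V' \<longrightarrow> orth S V V') \<and> (\<forall>V\<in>\<V>. p V \<in> proj_image S V (mspace X))"
  then obtain x where x: "x \<in> mspace X" "\<forall>V\<in>\<V>. dist_at_set S V x {p V} \<le> ennreal \<alpha>"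
    "\<forall>V\<in>\<V>. \<forall>W\<in>domains S. pnested S V W \<or> transverse S W V \<longrightarrow>
      dist_at_set S W x (rho_set S V W) \<le> ennreal \<alpha>"
    using assms(1) unfolding hhs_partial_realization_def by metis
  have *: "\<And>a. a \<le> ennreal \<alpha> \<Longrightarrow> a \<le> ennreal \<alpha>'"
    using assms(2) by (auto intro: order_trans ennreal_leI)
  show "\<exists>x\<in>mspace X. (\<forall>V\<in>\<V>. dist_at_set S V x {p V} \<le> ennreal \<alpha>') \<and>
      (\<forall>V\<in>\<V>. \<forall>W\<in>domains S. pnested S V W \<or> transverse S W V \<longrightarrow>
        dist_at_set S W x (rho_set S V W) \<le> ennreal \<alpha>')"
    using x by (intro bexI[of _ x] conjI ballI impI) (blast intro: *)+
qed


section \<open>The product structure\<close>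

text \<open>
  An index \<open>(A, B)\<close> stands for the product of the domains \<open>A\<close> and \<open>B\<close>, where \<^const>\<open>None\<close> is a trivial factor:
  it is nested in every domain and orthogonal to every domain. An index with two nontrivial
  factors gets a one-point hyperbolic space.
\<close>

definition opt_domains :: "('a, 'i, 'c) hhs_structure \<Rightarrow> 'i option set" where
  "opt_domains S = insert None (Some ` domains S)"

fun opt_nested :: "('a, 'i, 'c) hhs_structure \<Rightarrow> 'i option \<Rightarrow> 'i option \<Rightarrow> bool" where
  "opt_nested S None B \<longleftrightarrow> True"
| "opt_nested S (Some U) None \<longleftrightarrow> False"
| "opt_nested S (Some U) (Some V) \<longleftrightarrow> nested S U V"

fun opt_orth :: "('a, 'i, 'c) hhs_structure \<Rightarrow> 'i option \<Rightarrow> 'i option \<Rightarrow> bool" where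
  "opt_orth S (Some U) (Some V) \<longleftrightarrow> orth S U V"
| "opt_orth S _ _ \<longleftrightarrow> True"

fun prod_hyp_space ::
    "('a, 'i, 'c) hhs_structure \<Rightarrow> ('b, 'j, 'd) hhs_structure \<Rightarrow> 'i option \<times> 'j option \<Rightarrow> ('c + 'd) metric"
  where
  "prod_hyp_space S T (Some U, None) = image_metric Inl (hyp_space S U)"
| "prod_hyp_space S T (None, Some V) = image_metric Inr (hyp_space T V)"
| "prod_hyp_space S T _ = point_metric (Inl undefined)"

text \<open>\<open>Inl undefined\<close> is an arbitrary name for the only point of the one-point
  space. The last equation also covers \<open>(None, None)\<close>, which is not a domain.\<close>

fun prod_proj ::
    "('a, 'i, 'c) hhs_structure \<Rightarrow> ('b, 'j, 'd) hhs_structure \<Rightarrow> 'i option \<times> 'j option \<Rightarrow> 'a \<times> 'b \<Rightarrow>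
     ('c + 'd) set"
  where
  "prod_proj S T (Some U, None) x = Inl ` proj S U (fst x)"
| "prod_proj S T (None, Some V) x = Inr ` proj T V (snd x)"
| "prod_proj S T _ x = {Inl undefined}"

text \<open>
  The result is arbitrary when the relevant coordinate of \<open>V\<close> is \<^const>\<open>None\<close>; then \<open>V\<close> is
  orthogonal to the target, so that \<open>\<rho>\<^sup>V\<close> plays no role there.
\<close>

fun prod_rho_set ::
    "('a, 'i, 'c) hhs_structure \<Rightarrow> ('b, 'j, 'd) hhs_structure \<Rightarrow>
     'i option \<times> 'j option \<Rightarrow> 'i option \<times> 'j option \<Rightarrow> ('c + 'd) set"
  where
  "prod_rho_set S T V (Some W, None) = Inl ` rho_set S (the (fst V)) W"
| "prod_rho_set S T V (None, Some W) = Inr ` rho_set T (the (snd V)) W"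
| "prod_rho_set S T V _ = {Inl undefined}"

text \<open>
  Empty values are harmless for \<open>W\<close> with two nontrivial factors: every geodesic of its one-point
  space meets \<open>\<rho>\<^sup>V\<^sub>W\<close>.
\<close>

fun prod_rho_map ::
    "('a, 'i, 'c) hhs_structure \<Rightarrow> ('b, 'j, 'd) hhs_structure \<Rightarrow>
     'i option \<times> 'j option \<Rightarrow> 'i option \<times> 'j option \<Rightarrow> 'c + 'd \<Rightarrow> ('c + 'd) set"
  where
  "prod_rho_map S T (Some W, None) (Some V, None) p = Inl ` rho_map S W V (projl p)"
| "prod_rho_map S T (None, Some W) (None, Some V) p = Inr ` rho_map T W V (projr p)"
| "prod_rho_map S T _ _ p = {}"

definition prod_hhs ::
    "('a, 'i, 'c) hhs_structure \<Rightarrow> ('b, 'j, 'd) hhs_structure \<Rightarrow>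
     ('a \<times> 'b, 'i option \<times> 'j option, 'c + 'd) hhs_structure"
  where
  "prod_hhs S T =
     \<lparr>domains = opt_domains S \<times> opt_domains T - {(None, None)},
      hyp_space = prod_hyp_space S T,
      proj = prod_proj S T,
      nested = (\<lambda>V W. opt_nested S (fst V) (fst W) \<and> opt_nested T (snd V) (snd W)),
      orth = (\<lambda>V W. opt_orth S (fst V) (fst W) \<and> opt_orth T (snd V) (snd W)),
      rho_set = prod_rho_set S T,
      rho_map = prod_rho_map S T\<rparr>"

section \<open>Reduction of product data to the factors\<close>

lemma prod_hhs_simps [simp]:
  "domains (prod_hhs S T) = opt_domains S \<times> opt_domains T - {(None, None)}"
  "hyp_space (prod_hhs S T) = prod_hyp_space S T"
  "proj (prod_hhs S T) = prod_proj S T"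
  "nested (prod_hhs S T) V W \<longleftrightarrow> opt_nested S (fst V) (fst W) \<and> opt_nested T (snd V) (snd W)"
  "orth (prod_hhs S T) V W \<longleftrightarrow> opt_orth S (fst V) (fst W) \<and> opt_orth T (snd V) (snd W)"
  "rho_set (prod_hhs S T) = prod_rho_set S T"
  "rho_map (prod_hhs S T) = prod_rho_map S T"
  by (simp_all add: prod_hhs_def)

lemma opt_domains_simps [simp]: "None \<in> opt_domains S" "Some U \<in> opt_domains S \<longleftrightarrow> U \<in> domains S"
  by (auto simp: opt_domains_def)

lemma opt_nested_iff:
  "opt_nested S A B \<longleftrightarrow> A = None \<or> (\<exists>U V. A = Some U \<and> B = Some V \<and> nested S U V)"
  by (cases A; cases B) auto

lemma opt_orth_iff:
  "opt_orth S A B \<longleftrightarrow> A = None \<or> B = None \<or> (\<exists>U V. A = Some U \<and> B = Some V \<and> orth S U V)"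
  by (cases A; cases B) auto

lemma prod_domains_cases:
  assumes "W \<in> domains (prod_hhs S T)"
  obtains (left) U where "U \<in> domains S" "W = (Some U, None)"
    | (right) V where "V \<in> domains T" "W = (None, Some V)"
    | (both) U V where "U \<in> domains S" "V \<in> domains T" "W = (Some U, Some V)"
  using assms by (auto simp: opt_domains_def)

lemma dist_at_prod [simp]:
  "dist_at (prod_hhs S T) (Some U, None) x y = dist_at S U (fst x) (fst y)"
  "dist_at (prod_hhs S T) (None, Some V) x y = dist_at T V (snd x) (snd y)"
  "dist_at (prod_hhs S T) (Some U, Some V) x y = 0"
  by (simp_all add: dist_at_def)

lemma dist_at_set_prod [simp]:
  "dist_at_set (prod_hhs S T) (Some U, None) x (Inl ` A) = dist_at_set S U (fst x) A"
  "dist_at_set (prod_hhs S T) (None, Some V) x (Inr ` B) = dist_at_set T V (snd x) B"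
  "dist_at_set (prod_hhs S T) (Some U, Some V) x {p} = 0"
  by (simp_all add: dist_at_set_def)

lemma dist_at_set_prod_singleton [simp]:
  "dist_at_set (prod_hhs S T) (Some U, None) x {Inl p} = dist_at_set S U (fst x) {p}"
  "dist_at_set (prod_hhs S T) (None, Some V) x {Inr q} = dist_at_set T V (snd x) {q}"
  by (simp_all add: dist_at_set_def)

lemma proj_image_singleton [simp]: "proj_image S U {x} = proj S U x"
  by (simp add: proj_image_def)

lemma proj_image_prod [simp]:
  "proj_image (prod_hhs S T) (Some U, None) (A \<times> B) = (if B = {} then {} else Inl ` proj_image S U A)"
  "proj_image (prod_hhs S T) (None, Some V) (A \<times> B) = (if A = {} then {} else Inr ` proj_image T V B)"
  "proj_image (prod_hhs S T) (Some U, Some V) (A \<times> B) = (if A \<times> B = {} then {} else {Inl undefined})"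
  by (auto simp: proj_image_def image_UN)

text \<open>Only \<open>None\<close> is nested in \<open>None\<close>, so the second component of
  \<open>V\<close> is trivial; then the first is not, since \<open>(None, None)\<close> is not a
  domain. Hence nothing new appears below a copy of a domain of the first factor.\<close>

lemma pnested_prod_left:
  assumes "pnested (prod_hhs S T) V (Some W, None)" "V \<in> domains (prod_hhs S T)"
  obtains V' where "V = (Some V', None)" "V' \<in> domains S" "pnested S V' W"
proof -
  obtain V' where V': "V = (Some V', None)" "V' \<in> domains S" "nested S V' W"
    using assms by (auto simp: pnested_def opt_nested_iff opt_domains_def)
  with assms(1) show thesis
    by (intro that) (auto simp: pnested_def)
qed

lemma pnested_prod_right:
  assumes "pnested (prod_hhs S T) V (None, Some W)" "V \<in> domains (prod_hhs S T)"
  obtains V' where "V = (None, Some V')" "V' \<in> domains T" "pnested T V' W"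
proof -
  obtain V' where V': "V = (None, Some V')" "V' \<in> domains T" "nested T V' W"
    using assms by (auto simp: pnested_def opt_nested_iff opt_domains_def)
  with assms(1) show thesis
    by (intro that) (auto simp: pnested_def)
qed

text \<open>Non-orthogonality makes the first component of \<open>V\<close> nontrivial. A nontrivial
  \<open>B\<close> by itself prevents \<open>V\<close> from being nested in
  \<open>(Some W, None)\<close>, which leaves room for \<open>V'\<close> to be properly nested in
  \<open>W\<close>; reflexivity at \<open>W\<close> excludes \<open>V' = W\<close>.\<close>

lemma transverse_prod_left:
  assumes "transverse (prod_hhs S T) V (Some W, None)" "V \<in> domains (prod_hhs S T)"
    and "nested S W W"
  obtains V' B where "V = (Some V', B)" "V' \<in> domains S" "B \<in> opt_domains T"
    "transverse S V' W \<or> (pnested S V' W \<and> B \<noteq> None)"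
proof -
  obtain V' B where V': "V = (Some V', B)" "V' \<in> domains S" "B \<in> opt_domains T"
      "\<not> orth S V' W" "\<not> nested S W V'"
    using assms by (auto simp: transverse_def opt_nested_iff opt_orth_iff opt_domains_def)
  with assms show thesis
    by (intro that) (auto simp: transverse_def pnested_def opt_nested_iff)
qed

lemma transverse_prod_right:
  assumes "transverse (prod_hhs S T) V (None, Some W)" "V \<in> domains (prod_hhs S T)"
    and "nested T W W"
  obtains A V' where "V = (A, Some V')" "V' \<in> domains T" "A \<in> opt_domains S"
    "transverse T V' W \<or> (pnested T V' W \<and> A \<noteq> None)"
proof -
  obtain V' A where V': "V = (A, Some V')" "V' \<in> domains T" "A \<in> opt_domains S"
      "\<not> orth T V' W" "\<not> nested T W V'"
    using assms by (auto simp: transverse_def opt_nested_iff opt_orth_iff opt_domains_def)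
  with assms show thesis
    by (intro that) (auto simp: transverse_def pnested_def opt_nested_iff)
qed

lemma transverse_sym:
  assumes "hhs_orthogonality S" "V \<in> domains S" "W \<in> domains S" "transverse S V W"
  shows "transverse S W V"
  using assms unfolding transverse_def hhs_orthogonality_def by blast

lemma hhs_projections_prod:
  assumes "hhs_projections X S \<xi> K" "hhs_projections Y T \<xi> K"
    and "mspace X \<noteq> {}" "mspace Y \<noteq> {}" "K \<ge> 0"
  shows "hhs_projections (l1_prod_metric X Y) (prod_hhs S T) \<xi> K"
  unfolding hhs_projections_def
proof (rule ballI)
  fix W assume "W \<in> domains (prod_hhs S T)"
  \<comment> \<open>A coordinate distance never exceeds the l1 distance, so the Lipschitz bound of a
    factor can be weakened to one in terms of the product metric.\<close>
  have *: "a \<le> ennreal (K * u + K) \<Longrightarrow> u \<le> v \<Longrightarrow> a \<le> ennreal (K * v + K)" for a u v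
    using \<open>K \<ge> 0\<close> by (meson add_right_mono ennreal_leI mult_left_mono order_trans)
  from \<open>W \<in> domains (prod_hhs S T)\<close>
  show "(\<forall>x\<in>mspace (l1_prod_metric X Y). proj (prod_hhs S T) W x \<noteq> {} \<and>
          proj (prod_hhs S T) W x \<subseteq> mspace (hyp_space (prod_hhs S T) W) \<and>
          set_diam (hyp_space (prod_hhs S T) W) (proj (prod_hhs S T) W x) \<le> ennreal \<xi>) \<and>
        (\<forall>x\<in>mspace (l1_prod_metric X Y). \<forall>y\<in>mspace (l1_prod_metric X Y).
          dist_at (prod_hhs S T) W x y \<le> ennreal (K * mdist (l1_prod_metric X Y) x y + K)) \<and>
        quasiconvex K (hyp_space (prod_hhs S T) W)
          (proj_image (prod_hhs S T) W (mspace (l1_prod_metric X Y)))"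
  proof (cases rule: prod_domains_cases)
    case (left U)
    then have "\<And>x. x \<in> mspace X \<Longrightarrow> proj S U x \<noteq> {} \<and> proj S U x \<subseteq> mspace (hyp_space S U) \<and>
          set_diam (hyp_space S U) (proj S U x) \<le> ennreal \<xi>"
      and lip: "\<And>x y. x \<in> mspace X \<Longrightarrow> y \<in> mspace X \<Longrightarrow> dist_at S U x y \<le> ennreal (K * mdist X x y + K)"
      and "quasiconvex K (hyp_space S U) (proj_image S U (mspace X))"
      using assms(1) unfolding hhs_projections_def by blast+
    \<comment> \<open>As the other factor is nonempty, the image of the product in this space is the
      copy of the image of the factor.\<close>
    then show ?thesis
      using left assms(3,4) by (auto simp: quasiconvex_image intro: *[OF lip])
  next
    case (right V)
    then have "\<And>x. x \<in> mspace Y \<Longrightarrow> proj T V x \<noteq> {} \<and> proj T V x \<subseteq> mspace (hyp_space T V) \<and>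
          set_diam (hyp_space T V) (proj T V x) \<le> ennreal \<xi>"
      and lip: "\<And>x y. x \<in> mspace Y \<Longrightarrow> y \<in> mspace Y \<Longrightarrow> dist_at T V x y \<le> ennreal (K * mdist Y x y + K)"
      and "quasiconvex K (hyp_space T V) (proj_image T V (mspace Y))"
      using assms(2) unfolding hhs_projections_def by blast+
    then show ?thesis
      using right assms(3,4) by (auto simp: quasiconvex_image intro: *[OF lip])
  next
    case (both U V)
    with assms show ?thesis by (auto intro: quasiconvex_point)
  qed
qed

section \<open>Nesting and orthogonality in the product\<close>

lemma hhs_nestingD:
  assumes "hhs_nesting S \<xi>"
  shows "\<And>U. U \<in> domains S \<Longrightarrow> nested S U U"
    and "\<And>U V. U \<in> domains S \<Longrightarrow> V \<in> domains S \<Longrightarrow> nested S U V \<Longrightarrow> nested S V U \<Longrightarrow> U = V"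
    and "\<And>U V W. U \<in> domains S \<Longrightarrow> V \<in> domains S \<Longrightarrow> W \<in> domains S \<Longrightarrow>
      nested S U V \<Longrightarrow> nested S V W \<Longrightarrow> nested S U W"
  using assms unfolding hhs_nesting_def by blast+

lemma hhs_nesting_rho:
  assumes "hhs_nesting S \<xi>" "V \<in> domains S" "W \<in> domains S" "pnested S V W"
  shows "rho_set S V W \<subseteq> mspace (hyp_space S W)"
    and "set_diam (hyp_space S W) (rho_set S V W) \<le> ennreal \<xi>"
    and "\<And>p. p \<in> mspace (hyp_space S W) \<Longrightarrow> rho_map S W V p \<subseteq> mspace (hyp_space S V)"
  using assms unfolding hhs_nesting_def by blast+

lemma hhs_orthogonalityD:
  assumes "hhs_orthogonality S"
  shows "\<And>V W. V \<in> domains S \<Longrightarrow> W \<in> domains S \<Longrightarrow> orth S V W \<Longrightarrow> orth S W V"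
    and "\<And>V. V \<in> domains S \<Longrightarrow> \<not> orth S V V"
    and "\<And>U V W. V \<in> domains S \<Longrightarrow> W \<in> domains S \<Longrightarrow> U \<in> domains S \<Longrightarrow>
      nested S V W \<Longrightarrow> orth S W U \<Longrightarrow> orth S V U"
    and "\<And>V W. V \<in> domains S \<Longrightarrow> W \<in> domains S \<Longrightarrow> orth S V W \<Longrightarrow> \<not> nested S V W"
  using assms unfolding hhs_orthogonality_def by blast+

lemma hhs_orthogonality_container:
  assumes "hhs_orthogonality S" "T \<in> domains S" "U \<in> domains_below S T"
    and "{V \<in> domains_below S T. orth S V U} \<noteq> {}"
  obtains W where "W \<in> domains S" "nested S W T" "W \<noteq> T"
    "\<And>V. V \<in> domains S \<Longrightarrow> orth S V U \<Longrightarrow> nested S V T \<Longrightarrow> nested S V W"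
proof -
  have "\<forall>T\<in>domains S. \<forall>U\<in>domains_below S T. {V \<in> domains_below S T. orth S V U} \<noteq> {} \<longrightarrow>
      (\<exists>W\<in>domains_below S T - {T}. \<forall>V\<in>domains S. orth S V U \<and> nested S V T \<longrightarrow> nested S V W)"
    using assms(1) unfolding hhs_orthogonality_def by (elim conjE)
  from this[THEN bspec, THEN bspec, THEN mp, OF assms(2-4)] show thesis using that by (auto simp: domains_below_def)
qed

lemma opt_nested_refl:
  "hhs_nesting S \<xi> \<Longrightarrow> A \<in> opt_domains S \<Longrightarrow> opt_nested S A A"
  by (cases A) (auto intro: hhs_nestingD)

lemma opt_nested_antisym:
  "hhs_nesting S \<xi> \<Longrightarrow> A \<in> opt_domains S \<Longrightarrow> B \<in> opt_domains S \<Longrightarrow>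
   opt_nested S A B \<Longrightarrow> opt_nested S B A \<Longrightarrow> A = B"
  by (cases A; cases B) (auto intro: hhs_nestingD(2))

lemma opt_nested_trans:
  "hhs_nesting S \<xi> \<Longrightarrow> A \<in> opt_domains S \<Longrightarrow> B \<in> opt_domains S \<Longrightarrow> C \<in> opt_domains S \<Longrightarrow>
   opt_nested S A B \<Longrightarrow> opt_nested S B C \<Longrightarrow> opt_nested S A C"
  by (auto simp: opt_nested_iff intro: hhs_nestingD(3))

text \<open>
  By finite complexity every domain is nested in a maximal one, so the unique maximal domain is
  the largest one.
\<close>

lemma opt_domains_greatest:
  assumes S: "hhs_nesting S \<xi>" and n: "hhs_complexity S n"
  obtains M where "M \<in> opt_domains S" "\<forall>A\<in>opt_domains S. opt_nested S A M"
proof (cases "domains S = {}")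
  case True
  then show thesis using that[of None] by (auto simp: opt_domains_def)
next
  case False
  then obtain M where M: "M \<in> domains S" "\<forall>W\<in>domains S. nested S M W \<longrightarrow> W = M"
    and unique: "\<And>M'. M' \<in> domains S \<Longrightarrow> \<forall>W\<in>domains S. nested S M' W \<longrightarrow> W = M' \<Longrightarrow> M' = M"
    using S unfolding hhs_nesting_def by metis
  have refl: "\<forall>U\<in>domains S. nested S U U"
    and antisym: "\<forall>U\<in>domains S. \<forall>V\<in>domains S. nested S U V \<and> nested S V U \<longrightarrow> U = V"
    and trans: "\<forall>U\<in>domains S. \<forall>V\<in>domains S. \<forall>W\<in>domains S. nested S U V \<and> nested S V W \<longrightarrow> nested S U W"
    using S unfolding hhs_nesting_def by blast+
  have "nested S U M" if U: "U \<in> domains S" for U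
  proof -
    \<comment> \<open>Among the chains with smallest element \<open>U\<close>, one of greatest size
      exists by finite complexity. Its top is a maximal domain, since any further domain above the
      top could be added to the chain.\<close>
    define chain where "chain C \<longleftrightarrow> U \<in> C \<and> C \<subseteq> domains S \<and>
        (\<forall>V\<in>C. nested S U V) \<and> (\<forall>V\<in>C. \<forall>W\<in>C. nested S V W \<or> nested S W V)" for C
    have bounded: "finite C \<and> card C \<le> n" if "chain C" for C
      using n that unfolding hhs_complexity_def chain_def by blast
    have "chain {U}" using U refl by (auto simp: chain_def)
    then obtain C where C: "chain C" and longest: "\<And>D. chain D \<Longrightarrow> card D \<le> card C"
      using bounded ex_has_greatest_nat[of chain "{U}" card "Suc n"] by (metis le_imp_less_Suc)
    have top: "\<exists>V\<in>D. \<forall>W\<in>D. nested S W V"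
      if "finite D" "D \<noteq> {}" "D \<subseteq> domains S" "\<forall>V\<in>D. \<forall>W\<in>D. nested S V W \<or> nested S W V" for D
      using that
    proof (induction D rule: finite_ne_induct)
      case (singleton V)
      then show ?case using refl by auto
    next
      case (insert V D)
      then obtain V' where V': "V' \<in> D" "\<forall>W\<in>D. nested S W V'" by auto
      show ?case
      proof (cases "nested S V V'")
        case True
        then show ?thesis using V' by auto
      next
        case False
        then have "nested S V' V" using insert.prems V' by blast
        then have "\<forall>W\<in>insert V D. nested S W V" using V' insert.prems refl trans by blast
        then show ?thesis by blast
      qed
    qed
    obtain V where V: "V \<in> C" "\<forall>W\<in>C. nested S W V"
      using top[of C] C bounded[OF C] unfolding chain_def by blast
    have "W = V" if W: "W \<in> domains S" "nested S V W" for W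
    proof -
      have CW: "\<forall>Z\<in>C. nested S Z W" using V W C trans unfolding chain_def by blast
      then have "chain (insert W C)" using C W refl unfolding chain_def by blast
      then have "W \<in> C" using longest[of "insert W C"] bounded[OF C] by (auto simp: card_insert_if split: if_splits)
      then show ?thesis using V W C antisym unfolding chain_def by blast
    qed
    then have "V = M" using unique V C unfolding chain_def by blast
    then show ?thesis using V C unfolding chain_def by blast
  qed
  then show thesis using that[of "Some M"] M by (auto simp: opt_domains_def)
qed

lemma hhs_nesting_prod:
  assumes S: "hhs_nesting S \<xi>" "hhs_complexity S m" and T: "hhs_nesting T \<xi>" "hhs_complexity T n"
  shows "hhs_nesting (prod_hhs S T) \<xi>"
proof -
  let ?P = "prod_hhs S T"
  obtain M where M: "M \<in> opt_domains S" "\<forall>A\<in>opt_domains S. opt_nested S A M"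
    using opt_domains_greatest[OF S] .
  obtain N where N: "N \<in> opt_domains T" "\<forall>B\<in>opt_domains T. opt_nested T B N"
    using opt_domains_greatest[OF T] .
  have max: "\<exists>!M. M \<in> domains ?P \<and> (\<forall>W\<in>domains ?P. nested ?P M W \<longrightarrow> W = M)"
    if nonempty: "domains ?P \<noteq> {}"
  proof -
    obtain A B where AB: "(A, B) \<in> domains ?P" using nonempty by fast
    \<comment> \<open>Some product domain \<open>(A, B)\<close> exists and is nested in
      \<open>(M, N)\<close>, whereas only the excluded pair is nested in
      \<open>(None, None)\<close>.\<close>
    have "(M, N) \<noteq> (None, None)"
    proof
      assume "(M, N) = (None, None)"
      then show False using AB M N by (auto simp: opt_nested_iff)
    qed
    then have MN: "(M, N) \<in> domains ?P" using M N by simp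
    have le: "nested ?P W (M, N)" if "W \<in> domains ?P" for W
      using that M N by auto
    show ?thesis
    proof (rule ex1I[of _ "(M, N)"])
      have "W = (M, N)" if W: "W \<in> domains ?P" and MW: "nested ?P (M, N) W" for W
      proof -
        have "fst W = M" "snd W = N"
          using le[OF W] MW W M(1) N(1) opt_nested_antisym[OF S(1)] opt_nested_antisym[OF T(1)] by auto
        then show ?thesis by (metis prod.collapse)
      qed
      then show "(M, N) \<in> domains ?P \<and> (\<forall>W\<in>domains ?P. nested ?P (M, N) W \<longrightarrow> W = (M, N))"
        using MN by blast
    next
      fix W assume "W \<in> domains ?P \<and> (\<forall>V\<in>domains ?P. nested ?P W V \<longrightarrow> V = W)"
      then show "W = (M, N)" using le MN by metis
    qed
  qed
  have rho: "rho_set ?P V W \<subseteq> mspace (hyp_space ?P W) \<and>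
      set_diam (hyp_space ?P W) (rho_set ?P V W) \<le> ennreal \<xi> \<and>
      (\<forall>p\<in>mspace (hyp_space ?P W). rho_map ?P W V p \<subseteq> mspace (hyp_space ?P V))"
    if V: "V \<in> domains ?P" and W: "W \<in> domains ?P" and VW: "pnested ?P V W" for V W
    using W
  proof (cases rule: prod_domains_cases)
    case (left U)
    obtain V' where "V = (Some V', None)" "V' \<in> domains S" "pnested S V' U"
      using pnested_prod_left VW V left by metis
    then show ?thesis using hhs_nesting_rho[OF S(1), of V' U] left by auto
  next
    case (right U)
    obtain V' where "V = (None, Some V')" "V' \<in> domains T" "pnested T V' U"
      using pnested_prod_right VW V right by metis
    then show ?thesis using hhs_nesting_rho[OF T(1), of V' U] right by auto
  next
    case (both U U')
    then show ?thesis by simp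
  qed
  have refl: "nested ?P U U" if "U \<in> domains ?P" for U
    using that opt_nested_refl[OF S(1)] opt_nested_refl[OF T(1)] by auto
  have antisym: "U = V"
    if "U \<in> domains ?P" "V \<in> domains ?P" "nested ?P U V \<and> nested ?P V U" for U V
    using that opt_nested_antisym[OF S(1), of "fst U" "fst V"]
      opt_nested_antisym[OF T(1), of "snd U" "snd V"] by (auto simp: prod_eq_iff)
  have trans: "nested ?P U W"
    if "U \<in> domains ?P" "V \<in> domains ?P" "W \<in> domains ?P" "nested ?P U V \<and> nested ?P V W" for U V W
    using that opt_nested_trans[OF S(1), of "fst U" "fst V" "fst W"]
      opt_nested_trans[OF T(1), of "snd U" "snd V" "snd W"] by auto
  show ?thesis
    unfolding hhs_nesting_def
  proof (intro conjI)
    show "domains ?P = {} \<or> (\<exists>!M. M \<in> domains ?P \<and> (\<forall>W\<in>domains ?P. nested ?P M W \<longrightarrow> W = M))"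
      by (rule disjCI) (use max in argo)
    show "\<forall>U\<in>domains ?P. nested ?P U U" using refl by blast
    show "\<forall>U\<in>domains ?P. \<forall>V\<in>domains ?P. nested ?P U V \<and> nested ?P V U \<longrightarrow> U = V"
      using antisym by metis
    show "\<forall>U\<in>domains ?P. \<forall>V\<in>domains ?P. \<forall>W\<in>domains ?P.
        nested ?P U V \<and> nested ?P V W \<longrightarrow> nested ?P U W"
      using trans by metis
  qed (use rho in blast)
qed

text \<open>\<^const>\<open>None\<close> serves as the container when no domain nested in \<open>B\<close> is orthogonal to \<open>A\<close>.\<close>

lemma opt_container:
  assumes "hhs_orthogonality S" "A \<in> opt_domains S" "B \<in> opt_domains S" "opt_nested S A B"
    and "opt_nested S B B"
  obtains W where "W \<in> opt_domains S" "opt_nested S W B" "A = None \<or> W \<noteq> B"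
    "\<forall>C\<in>opt_domains S. opt_orth S C A \<and> opt_nested S C B \<longrightarrow> opt_nested S C W"
proof (cases A)
  case None
  \<comment> \<open>Everything is orthogonal to the trivial factor, so the container has to be all
    of \<open>B\<close>. Properness is lost in this case alone, which the disjunction
    \<open>A = None \<or> W \<noteq> B\<close> records.\<close>
  then show thesis using that[of B] assms by auto
next
  case (Some U)
  then obtain V where [simp]: "B = Some V" and U: "U \<in> domains S" "V \<in> domains S" "nested S U V"
    using assms by (cases B) auto
  show thesis
  proof (cases "{Z \<in> domains_below S V. orth S Z U} = {}")
    case True
    show thesis
      by (rule that[of None]) (use True Some in \<open>auto simp: opt_domains_def domains_below_def\<close>)
  next
    case False
    have "U \<in> domains_below S V" using U by (simp add: domains_below_def)
    then obtain W where "W \<in> domains S" "nested S W V" "W \<noteq> V"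
      "\<And>Z. Z \<in> domains S \<Longrightarrow> orth S Z U \<Longrightarrow> nested S Z V \<Longrightarrow> nested S Z W"
      using hhs_orthogonality_container[OF assms(1) U(2) _ False] by blast
    then have "\<forall>C\<in>opt_domains S. opt_orth S C A \<and> opt_nested S C B \<longrightarrow> opt_nested S C (Some W)"
      using Some by (auto simp: opt_domains_def)
    then show thesis
      using that[of "Some W"] \<open>W \<in> domains S\<close> \<open>nested S W V\<close> \<open>W \<noteq> V\<close> by simp
  qed
qed


lemma opt_orth_sym:
  "hhs_orthogonality S \<Longrightarrow> A \<in> opt_domains S \<Longrightarrow> B \<in> opt_domains S \<Longrightarrow> opt_orth S A B \<Longrightarrow> opt_orth S B A"
  by (auto simp: opt_orth_iff intro: hhs_orthogonalityD(1))

text \<open>With the trivial factor adjoined, anti-reflexivity fails at \<open>None\<close> and only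
  there. A pair orthogonal to itself would thus be \<open>(None, None)\<close>, which is not a
  domain; \<open>opt_orth_nested\<close> gives incomparability of orthogonal pairs by the same
  mechanism.\<close>

lemma opt_orth_refl: "hhs_orthogonality S \<Longrightarrow> A \<in> opt_domains S \<Longrightarrow> opt_orth S A A \<Longrightarrow> A = None"
  by (auto simp: opt_orth_iff dest: hhs_orthogonalityD(2))

lemma opt_orth_below:
  "hhs_orthogonality S \<Longrightarrow> A \<in> opt_domains S \<Longrightarrow> B \<in> opt_domains S \<Longrightarrow> C \<in> opt_domains S \<Longrightarrow>
   opt_nested S A B \<Longrightarrow> opt_orth S B C \<Longrightarrow> opt_orth S A C"
  by (auto simp: opt_orth_iff opt_nested_iff intro: hhs_orthogonalityD(3))

lemma opt_orth_nested:
  "hhs_orthogonality S \<Longrightarrow> A \<in> opt_domains S \<Longrightarrow> B \<in> opt_domains S \<Longrightarrow>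
   opt_orth S A B \<Longrightarrow> opt_nested S A B \<Longrightarrow> A = None"
  by (auto simp: opt_orth_iff opt_nested_iff dest: hhs_orthogonalityD(4))

lemma hhs_orthogonality_prod:
  assumes S: "hhs_orthogonality S" "hhs_nesting S \<xi>" and T: "hhs_orthogonality T" "hhs_nesting T \<xi>"
  shows "hhs_orthogonality (prod_hhs S T)"
proof -
  let ?P = "prod_hhs S T"
  have mem: "fst V \<in> opt_domains S \<and> snd V \<in> opt_domains T \<and> \<not> (fst V = None \<and> snd V = None)"
    if "V \<in> domains ?P" for V using that by auto
  have sym: "orth ?P W V" if "V \<in> domains ?P" "W \<in> domains ?P" "orth ?P V W" for V W
    using mem[OF that(1)] mem[OF that(2)] that(3) opt_orth_sym[OF S(1)] opt_orth_sym[OF T(1)] by simp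
  have irrefl: "\<not> orth ?P V V" if "V \<in> domains ?P" for V
    using mem[OF that] opt_orth_refl[OF S(1), of "fst V"] opt_orth_refl[OF T(1), of "snd V"] by auto
  have below: "orth ?P V U"
    if "V \<in> domains ?P" "W \<in> domains ?P" "U \<in> domains ?P" "nested ?P V W \<and> orth ?P W U" for U V W
    using mem[OF that(1)] mem[OF that(2)] mem[OF that(3)] that(4)
      opt_orth_below[OF S(1), of "fst V" "fst W" "fst U"]
      opt_orth_below[OF T(1), of "snd V" "snd W" "snd U"] by simp
  have incomparable: "\<not> nested ?P V W" if "V \<in> domains ?P" "W \<in> domains ?P" "orth ?P V W" for V W
    using mem[OF that(1)] mem[OF that(2)] that(3) opt_orth_nested[OF S(1), of "fst V" "fst W"]
      opt_orth_nested[OF T(1), of "snd V" "snd W"] by auto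
  have container: "\<exists>W\<in>domains_below ?P Z - {Z}. \<forall>V\<in>domains ?P. orth ?P V U \<and> nested ?P V Z \<longrightarrow> nested ?P V W"
    if Z: "Z \<in> domains ?P" and U: "U \<in> domains_below ?P Z"
      and ne: "{V \<in> domains_below ?P Z. orth ?P V U} \<noteq> {}" for Z U
  proof -
    have U': "U \<in> domains ?P" "opt_nested S (fst U) (fst Z)" "opt_nested T (snd U) (snd Z)"
      using U by (auto simp: domains_below_def)
    have mem: "fst U \<in> opt_domains S" "fst Z \<in> opt_domains S" "snd U \<in> opt_domains T" "snd Z \<in> opt_domains T"
      using mem[OF U'(1)] mem[OF Z] by blast+
    obtain A where A: "A \<in> opt_domains S" "opt_nested S A (fst Z)" "fst U = None \<or> A \<noteq> fst Z"
      "\<forall>C\<in>opt_domains S. opt_orth S C (fst U) \<and> opt_nested S C (fst Z) \<longrightarrow> opt_nested S C A"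
      using opt_container[OF S(1) mem(1,2) U'(2) opt_nested_refl[OF S(2) mem(2)]] .
    obtain B where B: "B \<in> opt_domains T" "opt_nested T B (snd Z)" "snd U = None \<or> B \<noteq> snd Z"
      "\<forall>C\<in>opt_domains T. opt_orth T C (snd U) \<and> opt_nested T C (snd Z) \<longrightarrow> opt_nested T C B"
      using opt_container[OF T(1) mem(3,4) U'(3) opt_nested_refl[OF T(2) mem(4)]] .
    have le: "nested ?P V (A, B)" if "V \<in> domains ?P" "orth ?P V U \<and> nested ?P V Z" for V
      using that A(4) B(4) by auto
    \<comment> \<open>The hypothesis \<open>ne\<close> supplies a domain that has to fit inside
      \<open>(A, B)\<close>, and no domain is nested in \<open>(None, None)\<close>.\<close>
    have "(A, B) \<noteq> (None, None)"
    proof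
      assume AB: "(A, B) = (None, None)"
      obtain V where "V \<in> domains ?P" "orth ?P V U \<and> nested ?P V Z"
        using ne unfolding domains_below_def by blast
      then show False using le[of V] AB by (cases V) (auto simp: opt_nested_iff)
    qed
    \<comment> \<open>At least one component of \<open>U\<close> is nontrivial, and there the
      container differs from the corresponding component of \<open>Z\<close>.\<close>
    moreover have "(A, B) \<noteq> Z"
    proof
      assume "(A, B) = Z"
      then have "U = (None, None)" using A(3) B(3) by (cases U) auto
      then show False using U'(1) by simp
    qed
    ultimately have "(A, B) \<in> domains_below ?P Z - {Z}"
      using A B by (auto simp: domains_below_def)
    then show ?thesis using le by blast
  qed
  show ?thesis
    unfolding hhs_orthogonality_def
  proof (intro conjI)
    show "\<forall>T'\<in>domains ?P. \<forall>U\<in>domains_below ?P T'. {V \<in> domains_below ?P T'. orth ?P V U} \<noteq> {} \<longrightarrow>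
      (\<exists>W\<in>domains_below ?P T' - {T'}. \<forall>V\<in>domains ?P. orth ?P V U \<and> nested ?P V T' \<longrightarrow> nested ?P V W)"
      using container by blast
  qed (use sym irrefl below incomparable in blast)+
qed

section \<open>Consistency, complexity, large links, bounded geodesic images and uniqueness\<close>

lemma hhs_consistency_prod:
  assumes X: "hhs_consistency X S \<xi> \<kappa>" and Y: "hhs_consistency Y T \<xi> \<kappa>"
    and S: "hhs_orthogonality S" "hhs_nesting S \<xi>" and T: "hhs_orthogonality T" "hhs_nesting T \<xi>"
  shows "hhs_consistency (l1_prod_metric X Y) (prod_hhs S T) \<xi> \<kappa>"
proof -
  let ?P = "prod_hhs S T" and ?XY = "l1_prod_metric X Y"
  note reflS = hhs_nestingD(1)[OF S(2)] and reflT = hhs_nestingD(1)[OF T(2)]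
  have P: "hhs_orthogonality ?P" by (rule hhs_orthogonality_prod[OF S T])
  note transS = hhs_consistency_def[THEN iffD1, OF X, THEN conjunct1, THEN bspec, THEN bspec, THEN mp]
  note transT = hhs_consistency_def[THEN iffD1, OF Y, THEN conjunct1, THEN bspec, THEN bspec, THEN mp]
  note nestS = hhs_consistency_def[THEN iffD1, OF X, THEN conjunct2, THEN conjunct1, THEN bspec, THEN bspec, THEN mp]
  note nestT = hhs_consistency_def[THEN iffD1, OF Y, THEN conjunct2, THEN conjunct1, THEN bspec, THEN bspec, THEN mp]
  note rhoS = hhs_consistency_def[THEN iffD1, OF X, THEN conjunct2, THEN conjunct2, THEN bspec, THEN bspec, THEN bspec, THEN mp]
  note rhoT = hhs_consistency_def[THEN iffD1, OF Y, THEN conjunct2, THEN conjunct2, THEN bspec, THEN bspec, THEN bspec, THEN mp]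

  \<comment> \<open>Proper nesting rather than transversality in the factor may stand behind a
    transverse pair; the nesting and transversality axioms bound the diameter of \<rho> by the same
    \<xi>.\<close>
  have rho_set: "rho_set ?P V W \<subseteq> mspace (hyp_space ?P W) \<and>
      set_diam (hyp_space ?P W) (rho_set ?P V W) \<le> ennreal \<xi>"
    if V: "V \<in> domains ?P" and W: "W \<in> domains ?P" and VW: "transverse ?P V W" for V W
    using W
  proof (cases rule: prod_domains_cases)
    case (left U)
    then obtain V' B where V': "V = (Some V', B)" "V' \<in> domains S" "transverse S V' U \<or> pnested S V' U"
      using transverse_prod_left[of S T V U] VW V reflS by metis
    then have "rho_set S V' U \<subseteq> mspace (hyp_space S U) \<and> set_diam (hyp_space S U) (rho_set S V' U) \<le> ennreal \<xi>"
      using transS[of V' U] hhs_nesting_rho[OF S(2), of V' U] left by blast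
    then show ?thesis using left V' by (simp add: image_mono)
  next
    case (right U)
    then obtain A V' where V': "V = (A, Some V')" "V' \<in> domains T" "transverse T V' U \<or> pnested T V' U"
      using transverse_prod_right[of S T V U] VW V reflT by metis
    then have "rho_set T V' U \<subseteq> mspace (hyp_space T U) \<and> set_diam (hyp_space T U) (rho_set T V' U) \<le> ennreal \<xi>"
      using transT[of V' U] hhs_nesting_rho[OF T(2), of V' U] right by blast
    then show ?thesis using right V' by (simp add: image_mono)
  next
    case (both U U')
    then show ?thesis by simp
  qed
  \<comment> \<open>In a one-point space every projection meets \<rho>. This settles each minimum
    below that involves a domain with two nontrivial components.\<close>
  have point: "dist_at_set ?P W x (rho_set ?P V W) = 0" if "fst W \<noteq> None" "snd W \<noteq> None" for V W x
    using that by (cases W) auto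
  have trans: "min (dist_at_set ?P W x (rho_set ?P V W)) (dist_at_set ?P V x (rho_set ?P W V)) \<le> ennreal \<kappa>"
    if V: "V \<in> domains ?P" and W: "W \<in> domains ?P" and VW: "transverse ?P V W" and x: "x \<in> mspace ?XY" for V W x
    using W
  proof (cases rule: prod_domains_cases)
    case (left U)
    then obtain V' B where V': "V = (Some V', B)" "V' \<in> domains S"
        "transverse S V' U \<or> (pnested S V' U \<and> B \<noteq> None)"
      using transverse_prod_left[of S T V U] VW V reflS by metis
    show ?thesis
    proof (cases B)
      case None
      then show ?thesis using V' left transS[of V' U] x by auto
    next
      case (Some B')
      then show ?thesis using V' point[of V x W] by simp
    qed
  next
    case (right U)
    then obtain A V' where V': "V = (A, Some V')" "V' \<in> domains T"
        "transverse T V' U \<or> (pnested T V' U \<and> A \<noteq> None)"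
      using transverse_prod_right[of S T V U] VW V reflT by metis
    show ?thesis
    proof (cases A)
      case None
      then show ?thesis using V' right transT[of V' U] x by auto
    next
      case (Some A')
      then show ?thesis using V' point[of V x W] by simp
    qed
  next
    case (both U U')
    then show ?thesis using point[of W x V] by simp
  qed
  have nest: "min (dist_at_set ?P W x (rho_set ?P V W))
      (set_diam (hyp_space ?P V) (proj ?P V x \<union> (\<Union>p\<in>proj ?P W x. rho_map ?P W V p))) \<le> ennreal \<kappa>"
    if V: "V \<in> domains ?P" and W: "W \<in> domains ?P" and VW: "pnested ?P V W" and x: "x \<in> mspace ?XY" for V W x
    using W
  proof (cases rule: prod_domains_cases)
    case (left U)
    then obtain V' where V': "V = (Some V', None)" "V' \<in> domains S" "pnested S V' U"
      using pnested_prod_left[of S T V U] VW V by metis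
    then show ?thesis
      using nestS[of V' U] left x by (auto simp flip: image_UN image_Un)
  next
    case (right U)
    then obtain V' where V': "V = (None, Some V')" "V' \<in> domains T" "pnested T V' U"
      using pnested_prod_right[of S T V U] VW V by metis
    then show ?thesis
      using nestT[of V' U] right x by (auto simp flip: image_UN image_Un)
  next
    case (both U U')
    then show ?thesis using point[of W x V] by simp
  qed
  have rho: "set_dist (hyp_space ?P W) (rho_set ?P U W) (rho_set ?P V W) \<le> ennreal \<kappa>"
    if U: "U \<in> domains ?P" and V: "V \<in> domains ?P" and W: "W \<in> domains ?P"
      and UV: "nested ?P U V" and VW: "pnested ?P V W \<or> (transverse ?P V W \<and> \<not> orth ?P W U)" for U V W
    using W
  proof (cases rule: prod_domains_cases)
    case (left W')
    \<comment> \<open>The first component of \<open>U\<close> cannot be trivial: in the nested case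
      \<open>U\<close> would be \<open>(None, None)\<close>, and in the transverse case
      \<open>U\<close> would be orthogonal to \<open>W\<close>.\<close>
    have "\<exists>U' V'. fst U = Some U' \<and> fst V = Some V' \<and> nested S U' V' \<and>
        (pnested S V' W' \<or> transverse S V' W' \<and> \<not> orth S W' U')"
      using VW
    proof
      assume "pnested ?P V W"
      then obtain V' where "V = (Some V', None)" "pnested S V' W'"
        using pnested_prod_left[of S T V W'] V left by metis
      then show ?thesis using U UV by (auto simp: opt_nested_iff)
    next
      assume asm: "transverse ?P V W \<and> \<not> orth ?P W U"
      then obtain V' B where V': "V = (Some V', B)" "transverse S V' W' \<or> pnested S V' W'"
        using transverse_prod_left[of S T V W'] V left reflS by metis
      then show ?thesis using UV asm left by (auto simp: opt_nested_iff opt_orth_iff)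
    qed
    then obtain U' V' where UV': "fst U = Some U'" "fst V = Some V'" "nested S U' V'"
        "pnested S V' W' \<or> transverse S V' W' \<and> \<not> orth S W' U'"
      by blast
    then have "U' \<in> domains S" "V' \<in> domains S"
      using U V by (metis mem_Times_iff DiffD1 opt_domains_simps(2) prod_hhs_simps(1))+
    then show ?thesis using UV' left rhoS[of U' V' W'] by simp
  next
    case (right W')
    have "\<exists>U' V'. snd U = Some U' \<and> snd V = Some V' \<and> nested T U' V' \<and>
        (pnested T V' W' \<or> transverse T V' W' \<and> \<not> orth T W' U')"
      using VW
    proof
      assume "pnested ?P V W"
      then obtain V' where "V = (None, Some V')" "pnested T V' W'"
        using pnested_prod_right[of S T V W'] V right by metis
      then show ?thesis using U UV by (auto simp: opt_nested_iff)
    next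
      assume asm: "transverse ?P V W \<and> \<not> orth ?P W U"
      then obtain V' B where V': "V = (B, Some V')" "transverse T V' W' \<or> pnested T V' W'"
        using transverse_prod_right[of S T V W'] V right reflT by metis
      then show ?thesis using UV asm right by (auto simp: opt_nested_iff opt_orth_iff)
    qed
    then obtain U' V' where UV': "snd U = Some U'" "snd V = Some V'" "nested T U' V'"
        "pnested T V' W' \<or> transverse T V' W' \<and> \<not> orth T W' U'"
      by blast
    then have "U' \<in> domains T" "V' \<in> domains T"
      using U V by (metis mem_Times_iff DiffD1 opt_domains_simps(2) prod_hhs_simps(1))+
    then show ?thesis using UV' right rhoT[of U' V' W'] by simp
  next
    case (both U' V')
    then show ?thesis by simp
  qed
  show ?thesis
    unfolding hhs_consistency_def
  proof (intro conjI ballI impI)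
    fix V W assume VW: "V \<in> domains ?P" "W \<in> domains ?P" "transverse ?P V W"
    note WV = transverse_sym[OF P VW]
    show "rho_set ?P V W \<subseteq> mspace (hyp_space ?P W)"
      "set_diam (hyp_space ?P W) (rho_set ?P V W) \<le> ennreal \<xi>"
      using rho_set[OF VW] by blast+
    show "rho_set ?P W V \<subseteq> mspace (hyp_space ?P V)"
      "set_diam (hyp_space ?P V) (rho_set ?P W V) \<le> ennreal \<xi>"
      using rho_set[OF VW(2,1) WV] by blast+
  qed (use trans nest rho in blast)+
qed

text \<open>Apart from \<open>None\<close>, which accounts for the successor, the elements of
  \<open>C\<close> come from a chain of domains of \<open>S\<close>.\<close>

lemma opt_chain_bound:
  assumes "hhs_complexity S n" "C \<subseteq> opt_domains S"
    and "\<forall>A\<in>C. \<forall>B\<in>C. opt_nested S A B \<or> opt_nested S B A"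
  shows "finite C" "card C \<le> Suc n"
proof -
  define D where "D = {U. Some U \<in> C}"
  have "D \<subseteq> domains S" "\<forall>V\<in>D. \<forall>W\<in>D. nested S V W \<or> nested S W V"
    using assms(2,3) by (fastforce simp: D_def)+
  then have D: "finite D" "card D \<le> n"
    using assms(1) unfolding hhs_complexity_def by blast+
  have C: "C \<subseteq> insert None (Some ` D)"
  proof
    fix A assume "A \<in> C"
    then show "A \<in> insert None (Some ` D)" by (cases A) (auto simp: D_def)
  qed
  then show "finite C" using D by (meson finite.insertI finite_imageI finite_subset)
  have "card C \<le> card (insert None (Some ` D))" using C D by (intro card_mono) auto
  also have "\<dots> \<le> Suc n" using D by (simp add: card_image)
  finally show "card C \<le> Suc n" .
qed

text \<open>The components of the elements of a chain form two chains, and the original chain lies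
  in the product of these. The bound is crude, but any bound will do.\<close>

lemma hhs_complexity_prod:
  assumes "hhs_complexity S m" "hhs_complexity T n"
  shows "hhs_complexity (prod_hhs S T) (Suc m * Suc n)"
  unfolding hhs_complexity_def
proof (intro allI impI)
  fix C assume C: "C \<subseteq> domains (prod_hhs S T)"
    and chain: "\<forall>V\<in>C. \<forall>W\<in>C. nested (prod_hhs S T) V W \<or> nested (prod_hhs S T) W V"
  have "fst ` C \<subseteq> opt_domains S" "snd ` C \<subseteq> opt_domains T"
    using C by auto
  moreover have "\<forall>A\<in>fst ` C. \<forall>B\<in>fst ` C. opt_nested S A B \<or> opt_nested S B A"
    "\<forall>A\<in>snd ` C. \<forall>B\<in>snd ` C. opt_nested T A B \<or> opt_nested T B A"
    using chain by fastforce+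
  ultimately have fin: "finite (fst ` C)" "finite (snd ` C)"
    and card: "card (fst ` C) \<le> Suc m" "card (snd ` C) \<le> Suc n"
    using opt_chain_bound[OF assms(1), of "fst ` C"] opt_chain_bound[OF assms(2), of "snd ` C"] by simp_all
  have sub: "C \<subseteq> fst ` C \<times> snd ` C" by (rule subset_fst_snd)
  then have "card C \<le> card (fst ` C) * card (snd ` C)"
    using fin by (metis card_cartesian_product card_mono finite_cartesian_product)
  also have "\<dots> \<le> Suc m * Suc n" using card by (rule mult_le_mono)
  finally show "finite C \<and> card C \<le> Suc m * Suc n"
    using finite_subset[OF sub finite_cartesian_product[OF fin]] by blast
qed

text \<open>What lies properly below a domain with one nontrivial component is an exact copy of what
  lies properly below that component, so the collection of the factor is copied. The bounds on
  \<open>lam\<close> and \<open>E\<close> are for the domains with two nontrivial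
  components.\<close>

lemma hhs_large_links_prod:
  assumes X: "hhs_large_links X S lam E" and Y: "hhs_large_links Y T lam E"
    and S: "hhs_nesting S \<xi>" and T: "hhs_nesting T \<xi>"
    and lam: "lam \<ge> 2" and E: "E \<ge> 1"
  shows "hhs_large_links (l1_prod_metric X Y) (prod_hhs S T) lam E"
  unfolding hhs_large_links_def Let_def
proof (intro ballI)
  let ?P = "prod_hhs S T" and ?XY = "l1_prod_metric X Y"
  fix W x x' assume W: "W \<in> domains ?P" and x: "x \<in> mspace ?XY" "x' \<in> mspace ?XY"
  let ?N = "lam * enn2real (dist_at ?P W x x') + lam"
  from W show "\<exists>\<T>\<subseteq>domains_below ?P W - {W}. finite \<T> \<and> int (card \<T>) \<le> \<lfloor>?N\<rfloor> \<and>
      (\<forall>Z\<in>domains_below ?P W - {W}. (\<exists>Z'\<in>\<T>. Z \<in> domains_below ?P Z') \<or> dist_at ?P Z x x' < ennreal E) \<and>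
      (\<forall>Z'\<in>\<T>. dist_at_set ?P W x (rho_set ?P Z' W) \<le> ennreal ?N)"
  proof (cases rule: prod_domains_cases)
    case (left U)
    have "fst x \<in> mspace X" "fst x' \<in> mspace X" using x by auto
    then obtain \<T> where \<T>: "\<T> \<subseteq> domains_below S U - {U}" "finite \<T>" "int (card \<T>) \<le> \<lfloor>?N\<rfloor>"
      "\<And>Z. Z \<in> domains_below S U - {U} \<Longrightarrow>
        (\<exists>Z'\<in>\<T>. Z \<in> domains_below S Z') \<or> dist_at S Z (fst x) (fst x') < ennreal E"
      "\<And>Z'. Z' \<in> \<T> \<Longrightarrow> dist_at_set S U (fst x) (rho_set S Z' U) \<le> ennreal ?N"
      using X[unfolded hhs_large_links_def Let_def, THEN bspec, THEN bspec, THEN bspec, of U "fst x" "fst x'"] left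
      by auto
    have sub: "domains_below ?P W - {W} = (\<lambda>Z. (Some Z, None)) ` (domains_below S U - {U})"
      using left by (auto simp: domains_below_def opt_nested_iff opt_domains_def)
    show ?thesis
    proof (intro exI[of _ "(\<lambda>Z. (Some Z, None)) ` \<T>"] conjI)
      show "(\<lambda>Z. (Some Z, None)) ` \<T> \<subseteq> domains_below ?P W - {W}"
        unfolding sub using \<T>(1) by blast
      show "\<forall>Z\<in>domains_below ?P W - {W}. (\<exists>Z'\<in>(\<lambda>Z. (Some Z, None)) ` \<T>. Z \<in> domains_below ?P Z') \<or>
          dist_at ?P Z x x' < ennreal E"
        unfolding sub using \<T>(4) by (fastforce simp: domains_below_def)
    qed (use \<T> left in \<open>auto simp: card_image inj_on_def\<close>)
  next
    case (right U)
    have "snd x \<in> mspace Y" "snd x' \<in> mspace Y" using x by auto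
    then obtain \<T> where \<T>: "\<T> \<subseteq> domains_below T U - {U}" "finite \<T>" "int (card \<T>) \<le> \<lfloor>?N\<rfloor>"
      "\<And>Z. Z \<in> domains_below T U - {U} \<Longrightarrow>
        (\<exists>Z'\<in>\<T>. Z \<in> domains_below T Z') \<or> dist_at T Z (snd x) (snd x') < ennreal E"
      "\<And>Z'. Z' \<in> \<T> \<Longrightarrow> dist_at_set T U (snd x) (rho_set T Z' U) \<le> ennreal ?N"
      using Y[unfolded hhs_large_links_def Let_def, THEN bspec, THEN bspec, THEN bspec, of U "snd x" "snd x'"] right
      by auto
    have sub: "domains_below ?P W - {W} = (\<lambda>Z. (None, Some Z)) ` (domains_below T U - {U})"
      using right by (auto simp: domains_below_def opt_nested_iff opt_domains_def)
    show ?thesis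
    proof (intro exI[of _ "(\<lambda>Z. (None, Some Z)) ` \<T>"] conjI)
      show "(\<lambda>Z. (None, Some Z)) ` \<T> \<subseteq> domains_below ?P W - {W}"
        unfolding sub using \<T>(1) by blast
      show "\<forall>Z\<in>domains_below ?P W - {W}. (\<exists>Z'\<in>(\<lambda>Z. (None, Some Z)) ` \<T>. Z \<in> domains_below ?P Z') \<or>
          dist_at ?P Z x x' < ennreal E"
        unfolding sub using \<T>(4) by (fastforce simp: domains_below_def)
    qed (use \<T> right in \<open>auto simp: card_image inj_on_def\<close>)
  next
    case (both U V)
    have "nested S U U" "nested T V V" using both hhs_nestingD(1) S T by metis+
    show ?thesis
    proof (intro exI[of _ "{(Some U, None), (None, Some V)}"] conjI)
      show "{(Some U, None), (None, Some V)} \<subseteq> domains_below ?P W - {W}"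
        using both \<open>nested S U U\<close> \<open>nested T V V\<close> by (auto simp: domains_below_def)
      \<comment> \<open>The distance in a one-point space is 0, so \<open>?N\<close> equals
        \<open>lam\<close>, which must leave room for two domains.\<close>
      show "int (card {(Some U, None), (None, Some V)}) \<le> \<lfloor>?N\<rfloor>"
        using both lam by (simp add: le_floor_iff)
      show "\<forall>Z\<in>domains_below ?P W - {W}. (\<exists>Z'\<in>{(Some U, None), (None, Some V)}. Z \<in> domains_below ?P Z') \<or>
          dist_at ?P Z x x' < ennreal E"
      proof
        fix Z assume "Z \<in> domains_below ?P W - {W}"
        then have Z: "Z \<in> domains ?P" "nested ?P Z W" by (auto simp: domains_below_def)
        from Z(1) show "(\<exists>Z'\<in>{(Some U, None), (None, Some V)}. Z \<in> domains_below ?P Z') \<or>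
            dist_at ?P Z x x' < ennreal E"
        proof (cases rule: prod_domains_cases)
          \<comment> \<open>Such a \<open>Z\<close> may lie below neither of the two domains, but it
            carries a point: its distance is 0 and hence strictly less than
            \<open>E\<close>.\<close>
          case (both A B)
          then show ?thesis using E by simp
        qed (use Z both in \<open>auto simp: domains_below_def\<close>)
      qed
    qed (use both in auto)
  qed
qed

text \<open>Domains properly nested in a copy of a domain of a factor are copies from the same
  factor, so the two alternatives are transported along \<open>Inl\<close> or
  \<open>Inr\<close>.\<close>

lemma hhs_bounded_geodesic_image_prod:
  assumes "hhs_bounded_geodesic_image S E" "hhs_bounded_geodesic_image T E"
  shows "hhs_bounded_geodesic_image (prod_hhs S T) E"
  unfolding hhs_bounded_geodesic_image_def
proof (intro ballI impI allI)
  let ?P = "prod_hhs S T"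
  fix V W x y Q
  assume V: "V \<in> domains ?P" and W: "W \<in> domains ?P" and VW: "pnested ?P V W"
    and Q: "geodesic_segment (hyp_space ?P W) x y Q"
  from W show "set_diam (hyp_space ?P V) (\<Union>p\<in>Q. rho_map ?P W V p) \<le> ennreal E \<or>
      (\<exists>p\<in>Q. set_dist (hyp_space ?P W) {p} (rho_set ?P V W) \<le> ennreal E)"
  proof (cases rule: prod_domains_cases)
    case (left U)
    then obtain V' where V': "V = (Some V', None)" "V' \<in> domains S" "pnested S V' U"
      using pnested_prod_left[of S T V U] VW V by metis
    have "geodesic_segment (image_metric Inl (hyp_space S U)) x y Q" using Q left by simp
    then obtain x' y' Q' where Q': "Q = Inl ` Q'" "geodesic_segment (hyp_space S U) x' y' Q'"
      using geodesic_segment_imageE[OF inj_Inl] by metis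
    then have "set_diam (hyp_space S V') (\<Union>p\<in>Q'. rho_map S U V' p) \<le> ennreal E \<or>
        (\<exists>p\<in>Q'. set_dist (hyp_space S U) {p} (rho_set S V' U) \<le> ennreal E)"
      using assms(1) V' left unfolding hhs_bounded_geodesic_image_def by blast
    then show ?thesis using V' left Q' by (auto simp flip: image_UN)
  next
    case (right U)
    then obtain V' where V': "V = (None, Some V')" "V' \<in> domains T" "pnested T V' U"
      using pnested_prod_right[of S T V U] VW V by metis
    have "geodesic_segment (image_metric Inr (hyp_space T U)) x y Q" using Q right by simp
    then obtain x' y' Q' where Q': "Q = Inr ` Q'" "geodesic_segment (hyp_space T U) x' y' Q'"
      using geodesic_segment_imageE[OF inj_Inr] by metis
    then have "set_diam (hyp_space T V') (\<Union>p\<in>Q'. rho_map T U V' p) \<le> ennreal E \<or>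
        (\<exists>p\<in>Q'. set_dist (hyp_space T U) {p} (rho_set T V' U) \<le> ennreal E)"
      using assms(2) V' right unfolding hhs_bounded_geodesic_image_def by blast
    then show ?thesis using V' right Q' by (auto simp flip: image_UN)
  next
    case (both U U')
    then show ?thesis using geodesic_segment_endpoints(1)[OF Q] by auto
  qed
qed

text \<open>Once the l1 distance reaches the sum of the two thresholds, one of the coordinates
  reaches its own threshold, and a domain of that factor separates the points.\<close>

lemma hhs_uniqueness_prod:
  assumes "hhs_uniqueness X S" "hhs_uniqueness Y T"
  shows "hhs_uniqueness (l1_prod_metric X Y) (prod_hhs S T)"
  unfolding hhs_uniqueness_def
proof (intro allI impI)
  fix \<kappa> :: real assume "\<kappa> \<ge> 0"
  then obtain \<theta> \<theta>' where
    S: "\<And>x y. x \<in> mspace X \<Longrightarrow> y \<in> mspace X \<Longrightarrow> mdist X x y \<ge> \<theta> \<Longrightarrow> \<exists>V\<in>domains S. dist_at S V x y \<ge> ennreal \<kappa>"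
    and T: "\<And>x y. x \<in> mspace Y \<Longrightarrow> y \<in> mspace Y \<Longrightarrow> mdist Y x y \<ge> \<theta>' \<Longrightarrow> \<exists>V\<in>domains T. dist_at T V x y \<ge> ennreal \<kappa>"
    using assms unfolding hhs_uniqueness_def by metis
  have "\<exists>V\<in>domains (prod_hhs S T). dist_at (prod_hhs S T) V (a, b) (a', b') \<ge> ennreal \<kappa>"
    if mem: "a \<in> mspace X" "a' \<in> mspace X" "b \<in> mspace Y" "b' \<in> mspace Y"
      and d: "mdist X a a' + mdist Y b b' \<ge> \<theta> + \<theta>'" for a a' b b'
  proof (cases "mdist X a a' \<ge> \<theta>")
    case True
    then obtain V where "V \<in> domains S" "dist_at S V a a' \<ge> ennreal \<kappa>" using S mem by blast
    then show ?thesis by (intro bexI[of _ "(Some V, None)"]) auto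
  next
    case False
    then obtain V where "V \<in> domains T" "dist_at T V b b' \<ge> ennreal \<kappa>" using T[of b b'] mem d by auto
    then show ?thesis by (intro bexI[of _ "(None, Some V)"]) auto
  qed
  then show "\<exists>\<theta>. \<forall>x\<in>mspace (l1_prod_metric X Y). \<forall>y\<in>mspace (l1_prod_metric X Y).
      mdist (l1_prod_metric X Y) x y \<ge> \<theta> \<longrightarrow>
      (\<exists>V\<in>domains (prod_hhs S T). dist_at (prod_hhs S T) V x y \<ge> ennreal \<kappa>)"
    by (intro exI[of _ "\<theta> + \<theta>'"]) auto
qed


section \<open>Partial realization\<close>

lemma hhs_partial_realizationE:
  assumes "hhs_partial_realization X S \<alpha>" "\<V> \<subseteq> domains S"
    and "\<forall>V\<in>\<V>. \<forall>V'\<in>\<V>. V \<noteq> V' \<longrightarrow> orth S V V'" "\<forall>V\<in>\<V>. p V \<in> proj_image S V (mspace X)"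
  obtains x where "x \<in> mspace X" "\<And>V. V \<in> \<V> \<Longrightarrow> dist_at_set S V x {p V} \<le> ennreal \<alpha>"
    "\<And>V W. V \<in> \<V> \<Longrightarrow> W \<in> domains S \<Longrightarrow> pnested S V W \<or> transverse S W V \<Longrightarrow>
      dist_at_set S W x (rho_set S V W) \<le> ennreal \<alpha>"
proof -
  from assms(1)[unfolded hhs_partial_realization_def, THEN spec, THEN mp, OF assms(2),
      THEN spec, THEN mp, OF conjI, OF assms(3,4)]
  obtain x where "x \<in> mspace X" "\<forall>V\<in>\<V>. dist_at_set S V x {p V} \<le> ennreal \<alpha>"
    and "\<forall>V\<in>\<V>. \<forall>W\<in>domains S. pnested S V W \<or> transverse S W V \<longrightarrow>
      dist_at_set S W x (rho_set S V W) \<le> ennreal \<alpha>" by blast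
  then show thesis by (intro that[of x]) blast+
qed

text \<open>The empty family, too, is realized by some point.\<close>

lemma hhs_partial_realization_nonempty: "hhs_partial_realization X S \<alpha> \<Longrightarrow> mspace X \<noteq> {}"
  unfolding hhs_partial_realization_def by (drule spec[of _ "{}"]) auto

lemma proj_image_nonempty:
  assumes "hhs_projections X S \<xi> K" "U \<in> domains S" "mspace X \<noteq> {}"
  shows "proj_image S U (mspace X) \<noteq> {}"
proof -
  obtain x where "x \<in> mspace X" using assms(3) by blast
  moreover from this have "proj S U x \<noteq> {}"
    using assms(1,2) unfolding hhs_projections_def by blast
  ultimately show ?thesis by (auto simp: proj_image_def)
qed

text \<open>The nontrivial first components of a pairwise orthogonal family are pairwise orthogonal
  in \<open>S\<close>, and likewise the second ones in \<open>T\<close>. The two families are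
  realized separately and the resulting points are paired; every clause then concerns a single
  coordinate or a one-point space.\<close>

lemma hhs_partial_realization_prod:
  assumes X: "hhs_partial_realization X S \<alpha>" "hhs_projections X S \<xi> K"
    and Y: "hhs_partial_realization Y T \<alpha>" "hhs_projections Y T \<xi> K"
    and S: "hhs_nesting S \<xi>" "hhs_orthogonality S" and T: "hhs_nesting T \<xi>" "hhs_orthogonality T"
  shows "hhs_partial_realization (l1_prod_metric X Y) (prod_hhs S T) \<alpha>"
  unfolding hhs_partial_realization_def
proof (intro allI impI, elim conjE)
  let ?P = "prod_hhs S T" and ?XY = "l1_prod_metric X Y"
  fix \<V> p
  assume \<V>: "\<V> \<subseteq> domains ?P" and orth: "\<forall>V\<in>\<V>. \<forall>V'\<in>\<V>. V \<noteq> V' \<longrightarrow> orth ?P V V'"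
    and p: "\<forall>V\<in>\<V>. p V \<in> proj_image ?P V (mspace ?XY)"
  have ne: "mspace X \<noteq> {}" "mspace Y \<noteq> {}"
    using X(1) Y(1) by (simp_all add: hhs_partial_realization_nonempty)
  have P: "hhs_orthogonality ?P" by (rule hhs_orthogonality_prod[OF S(2,1) T(2,1)])
  define \<V>0 where "\<V>0 = {U. \<exists>B. (Some U, B) \<in> \<V>}"
  define \<V>1 where "\<V>1 = {U. \<exists>A. (A, Some U) \<in> \<V>}"
  \<comment> \<open>A pair with two nontrivial components prescribes only the single point of its
    space. Its components still join the two families, since the conditions on \<rho> must hold for
    the pair, and the points prescribed for them may be chosen at will in the images of the
    projections.\<close>
  define p0 where "p0 U = (if (Some U, None) \<in> \<V> then projl (p (Some U, None))
      else SOME c. c \<in> proj_image S U (mspace X))" for U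
  define p1 where "p1 U = (if (None, Some U) \<in> \<V> then projr (p (None, Some U))
      else SOME c. c \<in> proj_image T U (mspace Y))" for U
  have sub: "\<V>0 \<subseteq> domains S" "\<V>1 \<subseteq> domains T"
    using \<V> by (auto simp: \<V>0_def \<V>1_def)
  have orth0: "\<forall>U\<in>\<V>0. \<forall>U'\<in>\<V>0. U \<noteq> U' \<longrightarrow> orth S U U'"
    using orth by (fastforce simp: \<V>0_def)
  have orth1: "\<forall>U\<in>\<V>1. \<forall>U'\<in>\<V>1. U \<noteq> U' \<longrightarrow> orth T U U'"
    using orth by (fastforce simp: \<V>1_def)
  have p0: "p0 U \<in> proj_image S U (mspace X)" if U: "U \<in> \<V>0" for U
  proof (cases "(Some U, None) \<in> \<V>")
    case True
    then have "p (Some U, None) \<in> Inl ` proj_image S U (mspace X)" using bspec[OF p True] ne by simp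
    then show ?thesis using True by (auto simp: p0_def)
  next
    case False
    have "proj_image S U (mspace X) \<noteq> {}"
      using proj_image_nonempty[OF X(2)] U sub ne by blast
    then show ?thesis using False by (simp add: p0_def some_in_eq)
  qed
  have p1: "p1 U \<in> proj_image T U (mspace Y)" if U: "U \<in> \<V>1" for U
  proof (cases "(None, Some U) \<in> \<V>")
    case True
    then have "p (None, Some U) \<in> Inr ` proj_image T U (mspace Y)" using bspec[OF p True] ne by simp
    then show ?thesis using True by (auto simp: p1_def)
  next
    case False
    have "proj_image T U (mspace Y) \<noteq> {}"
      using proj_image_nonempty[OF Y(2)] U sub ne by blast
    then show ?thesis using False by (simp add: p1_def some_in_eq)
  qed
  obtain x where x: "x \<in> mspace X" "\<And>V. V \<in> \<V>0 \<Longrightarrow> dist_at_set S V x {p0 V} \<le> ennreal \<alpha>"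
    "\<And>V W. V \<in> \<V>0 \<Longrightarrow> W \<in> domains S \<Longrightarrow> pnested S V W \<or> transverse S W V \<Longrightarrow>
      dist_at_set S W x (rho_set S V W) \<le> ennreal \<alpha>"
    using hhs_partial_realizationE[OF X(1) sub(1) orth0] p0 by blast
  obtain y where y: "y \<in> mspace Y" "\<And>V. V \<in> \<V>1 \<Longrightarrow> dist_at_set T V y {p1 V} \<le> ennreal \<alpha>"
    "\<And>V W. V \<in> \<V>1 \<Longrightarrow> W \<in> domains T \<Longrightarrow> pnested T V W \<or> transverse T W V \<Longrightarrow>
      dist_at_set T W y (rho_set T V W) \<le> ennreal \<alpha>"
    using hhs_partial_realizationE[OF Y(1) sub(2) orth1] p1 by blast
  show "\<exists>x\<in>mspace ?XY. (\<forall>V\<in>\<V>. dist_at_set ?P V x {p V} \<le> ennreal \<alpha>) \<and>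
      (\<forall>V\<in>\<V>. \<forall>W\<in>domains ?P. pnested ?P V W \<or> transverse ?P W V \<longrightarrow>
        dist_at_set ?P W x (rho_set ?P V W) \<le> ennreal \<alpha>)"
  proof (intro bexI[of _ "(x, y)"] conjI ballI impI)
    fix V assume V: "V \<in> \<V>"
    then have "V \<in> domains ?P" using \<V> by blast
    then show "dist_at_set ?P V (x, y) {p V} \<le> ennreal \<alpha>"
    proof (cases rule: prod_domains_cases)
      case (left U)
      then have "p V \<in> Inl ` proj_image S U (mspace X)" using bspec[OF p V] ne by simp
      then have "p V = Inl (p0 U)" "U \<in> \<V>0" using V left by (auto simp: p0_def \<V>0_def)
      then show ?thesis using x(2) left by simp
    next
      case (right U)
      then have "p V \<in> Inr ` proj_image T U (mspace Y)" using bspec[OF p V] ne by simp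
      then have "p V = Inr (p1 U)" "U \<in> \<V>1" using V right by (auto simp: p1_def \<V>1_def)
      then show ?thesis using y(2) right by simp
    next
      case (both U U')
      then have "p V = Inl undefined" using bspec[OF p V] ne by simp
      then show ?thesis using both by simp
    qed
  next
    fix V W assume V: "V \<in> \<V>" and W: "W \<in> domains ?P" and VW: "pnested ?P V W \<or> transverse ?P W V"
    have V': "V \<in> domains ?P" using V \<V> by blast
    have VW': "pnested ?P V W \<or> transverse ?P V W"
      using VW transverse_sym[OF P W V'] by blast
    from W show "dist_at_set ?P W (x, y) (rho_set ?P V W) \<le> ennreal \<alpha>"
    proof (cases rule: prod_domains_cases)
      case (left U)
      \<comment> \<open>If \<open>V\<close> is transverse to \<open>W\<close>, its first component
        may still be properly nested in \<open>U\<close>; the realization in the factor controls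
        \<rho> in both cases.\<close>
      obtain Z B where Z: "V = (Some Z, B)" "Z \<in> domains S" "pnested S Z U \<or> transverse S Z U"
        using VW' transverse_prod_left[of S T V U] pnested_prod_left[of S T V U] V' left
          hhs_nestingD(1)[OF S(1)] by metis
      then have "Z \<in> \<V>0" using V by (auto simp: \<V>0_def)
      moreover have "pnested S Z U \<or> transverse S U Z"
        using Z left transverse_sym[OF S(2)] by blast
      ultimately show ?thesis using x(3)[of Z U] left Z by simp
    next
      case (right U)
      obtain A Z where Z: "V = (A, Some Z)" "Z \<in> domains T" "pnested T Z U \<or> transverse T Z U"
        using VW' transverse_prod_right[of S T V U] pnested_prod_right[of S T V U] V' right
          hhs_nestingD(1)[OF T(1)] by metis
      then have "Z \<in> \<V>1" using V by (auto simp: \<V>1_def)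
      moreover have "pnested T Z U \<or> transverse T U Z"
        using Z right transverse_sym[OF T(2)] by blast
      ultimately show ?thesis using y(3)[of Z U] right Z by simp
    next
      case (both U U')
      then show ?thesis by simp
    qed
  qed (use x y in simp)
qed

section \<open>Assembly of the axioms\<close>

lemma hierarchically_hyperbolicE:
  assumes "hierarchically_hyperbolic X S"
  obtains \<xi> K \<kappa> lam E where "\<xi> \<ge> 0" "K \<ge> 0" "\<kappa> \<ge> 0" "lam \<ge> 1" "E \<ge> max \<xi> \<kappa>"
    "hhs_projections X S \<xi> K" "hhs_nesting S \<xi>" "hhs_consistency X S \<xi> \<kappa>" "hhs_large_links X S lam E"
  using assms unfolding hierarchically_hyperbolic_def by blast

theorem hierarchically_hyperbolic_prod:
  assumes X: "hierarchically_hyperbolic X S" and Y: "hierarchically_hyperbolic Y T"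
  shows "hierarchically_hyperbolic (l1_prod_metric X Y) (prod_hhs S T)"
proof -
  let ?P = "prod_hhs S T" and ?XY = "l1_prod_metric X Y"
  obtain q q' where "q \<ge> 1" "quasigeodesic_space q X" "q' \<ge> 1" "quasigeodesic_space q' Y"
    using X Y unfolding hierarchically_hyperbolic_def by blast
  then have 1: "\<exists>q\<ge>1. quasigeodesic_space q ?XY"
    using quasigeodesic_space_l1_prod by (intro exI[of _ "q + q'"]) auto

  obtain \<delta> \<delta>' where \<delta>: "\<delta> \<ge> 0" "\<forall>W\<in>domains S. geodesic_space (hyp_space S W) \<and> hyperbolic \<delta> (hyp_space S W)"
    and \<delta>': "\<delta>' \<ge> 0" "\<forall>W\<in>domains T. geodesic_space (hyp_space T W) \<and> hyperbolic \<delta>' (hyp_space T W)"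
    using X Y unfolding hierarchically_hyperbolic_def by blast
  have "geodesic_space (hyp_space ?P W) \<and> hyperbolic (max \<delta> \<delta>') (hyp_space ?P W)"
    if "W \<in> domains ?P" for W
    using that
  proof (cases rule: prod_domains_cases)
    case (left U)
    then have "geodesic_space (hyp_space S U)" "hyperbolic (max \<delta> \<delta>') (hyp_space S U)"
      using \<delta> hyperbolic_mono by fastforce+
    then show ?thesis using left by (simp add: geodesic_space_image hyperbolic_image)
  next
    case (right U)
    then have "geodesic_space (hyp_space T U)" "hyperbolic (max \<delta> \<delta>') (hyp_space T U)"
      using \<delta>' hyperbolic_mono by fastforce+
    then show ?thesis using right by (simp add: geodesic_space_image hyperbolic_image)
  next
    case (both U V)
    then show ?thesis by (simp add: geodesic_space_point hyperbolic_point)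
  qed
  then have 2: "\<exists>\<delta>\<ge>0. \<forall>W\<in>domains ?P. geodesic_space (hyp_space ?P W) \<and> hyperbolic \<delta> (hyp_space ?P W)"
    using \<delta> by (intro exI[of _ "max \<delta> \<delta>'"]) auto

  obtain \<xi>0 K0 \<kappa>0 l0 E0 where c0: "\<xi>0 \<ge> 0" "K0 \<ge> 0" "\<kappa>0 \<ge> 0" "l0 \<ge> 1" "E0 \<ge> max \<xi>0 \<kappa>0"
    and h0: "hhs_projections X S \<xi>0 K0" "hhs_nesting S \<xi>0" "hhs_consistency X S \<xi>0 \<kappa>0" "hhs_large_links X S l0 E0"
    using hierarchically_hyperbolicE[OF X] .
  obtain \<xi>1 K1 \<kappa>1 l1 E1 where c1: "\<xi>1 \<ge> 0" "K1 \<ge> 0" "\<kappa>1 \<ge> 0" "l1 \<ge> 1" "E1 \<ge> max \<xi>1 \<kappa>1"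
    and h1: "hhs_projections Y T \<xi>1 K1" "hhs_nesting T \<xi>1" "hhs_consistency Y T \<xi>1 \<kappa>1" "hhs_large_links Y T l1 E1"
    using hierarchically_hyperbolicE[OF Y] .
  \<comment> \<open>The maxima serve both factors at once. The summand 2 leaves room for the
    two-element collections in large links; the summand 1 puts distance 0 strictly below
    \<open>E\<close>.\<close>
  define \<xi> K \<kappa> lam E where "\<xi> = max \<xi>0 \<xi>1" and "K = max K0 K1" and "\<kappa> = max \<kappa>0 \<kappa>1"
    and "lam = 2 + max l0 l1" and "E = 1 + max E0 E1"
  note cdefs = \<xi>_def K_def \<kappa>_def lam_def E_def
  have S: "hhs_projections X S \<xi> K" "hhs_nesting S \<xi>" "hhs_consistency X S \<xi> \<kappa>" "hhs_large_links X S lam E"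
    and T: "hhs_projections Y T \<xi> K" "hhs_nesting T \<xi>" "hhs_consistency Y T \<xi> \<kappa>" "hhs_large_links Y T lam E"
    using hhs_projections_mono[OF h0(1), of \<xi> K] hhs_projections_mono[OF h1(1), of \<xi> K]
      hhs_nesting_mono[OF h0(2), of \<xi>] hhs_nesting_mono[OF h1(2), of \<xi>]
      hhs_consistency_mono[OF h0(3), of \<xi> \<kappa>] hhs_consistency_mono[OF h1(3), of \<xi> \<kappa>]
      hhs_large_links_mono[OF h0(4), of lam E] hhs_large_links_mono[OF h1(4), of lam E]
    by (auto simp: cdefs)
  have const_bounds: "\<xi> \<ge> 0" "K \<ge> 0" "\<kappa> \<ge> 0" "lam \<ge> 2" "E \<ge> 1" "E \<ge> max \<xi> \<kappa>"
    using c0 c1 by (auto simp: cdefs)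
  have orth: "hhs_orthogonality S" "hhs_orthogonality T" and unique: "hhs_uniqueness X S" "hhs_uniqueness Y T"
    using X Y unfolding hierarchically_hyperbolic_def by blast+
  obtain m n where mn: "hhs_complexity S m" "hhs_complexity T n"
    using X Y unfolding hierarchically_hyperbolic_def by blast
  obtain \<alpha>0 \<alpha>1 where "\<alpha>0 \<ge> 0" "hhs_partial_realization X S \<alpha>0" "hhs_partial_realization Y T \<alpha>1"
    using X Y unfolding hierarchically_hyperbolic_def by blast
  then have \<alpha>: "max \<alpha>0 \<alpha>1 \<ge> 0" "hhs_partial_realization X S (max \<alpha>0 \<alpha>1)" "hhs_partial_realization Y T (max \<alpha>0 \<alpha>1)"
    by (auto elim: hhs_partial_realization_mono)
  obtain e0 e1 where "e0 > 0" "hhs_bounded_geodesic_image S e0" "hhs_bounded_geodesic_image T e1"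
    using X Y unfolding hierarchically_hyperbolic_def by blast
  then have e: "max e0 e1 > 0" "hhs_bounded_geodesic_image S (max e0 e1)" "hhs_bounded_geodesic_image T (max e0 e1)"
    by (auto elim: hhs_bounded_geodesic_image_mono)
  have "hhs_projections ?XY ?P \<xi> K"
    by (rule hhs_projections_prod[OF S(1) T(1) hhs_partial_realization_nonempty[OF \<alpha>(2)]
      hhs_partial_realization_nonempty[OF \<alpha>(3)] const_bounds(2)])
  moreover have "hhs_nesting ?P \<xi>"
    by (rule hhs_nesting_prod[OF S(2) mn(1) T(2) mn(2)])
  moreover have "hhs_consistency ?XY ?P \<xi> \<kappa>"
    by (rule hhs_consistency_prod[OF S(3) T(3) orth(1) S(2) orth(2) T(2)])
  moreover have "hhs_large_links ?XY ?P lam E"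
    by (rule hhs_large_links_prod[OF S(4) T(4) S(2) T(2) const_bounds(4,5)])
  moreover have "lam \<ge> 1" using const_bounds by simp
  ultimately have 3: "\<exists>\<xi>\<ge>0. \<exists>K\<ge>0. \<exists>\<kappa>0\<ge>0. \<exists>lam\<ge>1. \<exists>E\<ge>max \<xi> \<kappa>0.
      hhs_projections ?XY ?P \<xi> K \<and> hhs_nesting ?P \<xi> \<and> hhs_consistency ?XY ?P \<xi> \<kappa>0 \<and> hhs_large_links ?XY ?P lam E"
    using const_bounds by blast
  have 4: "hhs_orthogonality ?P"
    by (rule hhs_orthogonality_prod[OF orth(1) S(2) orth(2) T(2)])
  have 5: "hhs_partial_realization ?XY ?P (max \<alpha>0 \<alpha>1)"
    by (rule hhs_partial_realization_prod[OF \<alpha>(2) S(1) \<alpha>(3) T(1) S(2) orth(1) T(2) orth(2)])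
  show ?thesis
    unfolding hierarchically_hyperbolic_def
    using 1 2 3 4 5 \<alpha>(1) e(1) hhs_complexity_prod[OF mn] hhs_bounded_geodesic_image_prod[OF e(2,3)]
      hhs_uniqueness_prod[OF unique] by blast
qed


section \<open>The inclusions of the factors\<close>

lemma hhs_rho_coarse_subset:
  assumes "hhs_nesting S \<xi>" "hhs_consistency X S \<xi> \<kappa>" "U \<in> domains S" "V \<in> domains S"
    and "U \<noteq> V" "\<not> orth S U V" "p \<in> mspace (hyp_space S U)"
  shows "rho_coarse S U V p \<subseteq> mspace (hyp_space S V)"
proof -
  \<comment> \<open>The values of \<open>rho_coarse\<close> are governed by a different clause in
    each case. Their containment in the carrier is what \<open>coarsely_equal_refl\<close> asks for
    when equal sets are to be coarsely equal.\<close>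
  consider "pnested S V U" | "\<not> pnested S V U" "pnested S U V" | "\<not> pnested S V U" "transverse S U V"
    using assms(5,6) by (auto simp: pnested_def transverse_def)
  then show ?thesis
  proof cases
    case 1
    then show ?thesis using hhs_nesting_rho(3) assms by (simp add: rho_coarse_def)
  next
    case 2
    then show ?thesis using hhs_nesting_rho(1) assms by (simp add: rho_coarse_def)
  next
    case 3
    then have "rho_set S U V \<subseteq> mspace (hyp_space S V)"
      using assms(2-4) unfolding hhs_consistency_def by blast
    then show ?thesis using 3 by (simp add: rho_coarse_def)
  qed
qed

text \<open>The contrapositive of uniqueness, with the bounds gathered in one function of \<kappa>,
  because hierarchical quasiconvexity wants a single function for all \<kappa>.\<close>

lemma hhs_uniqueness_close:
  assumes "hhs_uniqueness X S"
  obtains \<theta> where "\<And>\<kappa>. \<theta> \<kappa> \<ge> 0"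
    "\<And>\<kappa> x y. \<kappa> \<ge> 0 \<Longrightarrow> x \<in> mspace X \<Longrightarrow> y \<in> mspace X \<Longrightarrow>
      \<forall>V\<in>domains S. dist_at S V x y \<le> ennreal \<kappa> \<Longrightarrow> mdist X x y \<le> \<theta> \<kappa>"
proof -
  \<comment> \<open>Distances are known to be at most \<kappa>, while uniqueness produces one that
    is at least its threshold; with the threshold \<open>\<kappa> + 1\<close> the two are
    incompatible.\<close>
  have "\<forall>\<kappa>\<in>{0..}. \<exists>\<theta>. \<forall>x\<in>mspace X. \<forall>y\<in>mspace X.
      mdist X x y \<ge> \<theta> \<longrightarrow> (\<exists>V\<in>domains S. dist_at S V x y \<ge> ennreal (\<kappa> + 1))"
  proof
    fix \<kappa> :: real assume "\<kappa> \<in> {0..}"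
    then have "\<kappa> + 1 \<ge> 0" by simp
    then show "\<exists>\<theta>. \<forall>x\<in>mspace X. \<forall>y\<in>mspace X.
        mdist X x y \<ge> \<theta> \<longrightarrow> (\<exists>V\<in>domains S. dist_at S V x y \<ge> ennreal (\<kappa> + 1))"
      using assms unfolding hhs_uniqueness_def by blast
  qed
  from bchoice[OF this] obtain \<theta> where \<theta>: "\<forall>\<kappa>\<in>{0..}. \<forall>x\<in>mspace X. \<forall>y\<in>mspace X.
      mdist X x y \<ge> \<theta> \<kappa> \<longrightarrow> (\<exists>V\<in>domains S. dist_at S V x y \<ge> ennreal (\<kappa> + 1))" ..
  show thesis
  proof (rule that[of "\<lambda>\<kappa>. max 0 (\<theta> \<kappa>)"])
    fix \<kappa> x y
    assume \<kappa>: "(0::real) \<le> \<kappa>" and xy: "x \<in> mspace X" "y \<in> mspace X"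
      and d: "\<forall>V\<in>domains S. dist_at S V x y \<le> ennreal \<kappa>"
    have lt: "ennreal \<kappa> < ennreal (\<kappa> + 1)" using \<kappa> by (simp add: ennreal_less_iff)
    have "\<not> ennreal (\<kappa> + 1) \<le> dist_at S V x y" if "V \<in> domains S" for V
      using d that lt by (meson leD order_trans)
    then show "mdist X x y \<le> max 0 (\<theta> \<kappa>)"
      using \<theta>[THEN bspec, THEN bspec, THEN bspec, of \<kappa> x y] \<kappa> xy by fastforce
  qed simp
qed

text \<open>On domains \<open>(Some U, None)\<close> the product data are copies of those of
  \<open>S\<close>, so every error of the hieromorphism is 0, and the inclusion is isometric. What
  remains is to bound the distance from a point to the slice through \<open>b\<close>, using the
  domains \<open>(None, Some V)\<close>.\<close>

lemma quasiconvex_hieromorphism_prod_left: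
  assumes X: "hierarchically_hyperbolic X S" and Y: "hierarchically_hyperbolic Y T" and b: "b \<in> mspace Y"
  shows "quasiconvex_hieromorphism X S (l1_prod_metric X Y) (prod_hhs S T)
    (\<lambda>x. (x, b)) (\<lambda>U. (Some U, None)) (\<lambda>_. Inl)"
proof -
  let ?P = "prod_hhs S T" and ?XY = "l1_prod_metric X Y"
  obtain \<xi> K \<kappa> where c: "K \<ge> 0"
    and h: "hhs_projections X S \<xi> K" "hhs_nesting S \<xi>" "hhs_consistency X S \<xi> \<kappa>"
    using hierarchically_hyperbolicE[OF X] .
  obtain \<xi>' K' where h': "hhs_projections Y T \<xi>' K'"
    using hierarchically_hyperbolicE[OF Y] .
  have "mspace X \<noteq> {}"
    using X unfolding hierarchically_hyperbolic_def by (blast dest: hhs_partial_realization_nonempty)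
  have proj: "proj S U x \<subseteq> mspace (hyp_space S U)" if "U \<in> domains S" "x \<in> mspace X" for U x
    using h(1) that unfolding hhs_projections_def by blast
  have rho: "rho_coarse ?P (Some U, None) (Some V, None) (Inl p) = Inl ` rho_coarse S U V p" for U V p
    by (simp add: rho_coarse_def pnested_def)

  have hiero: "hieromorphism X S ?XY ?P (\<lambda>x. (x, b)) (\<lambda>U. (Some U, None)) (\<lambda>_. Inl)"
    unfolding hieromorphism_def
  proof (intro conjI)
    show "(\<lambda>x. (x, b)) ` mspace X \<subseteq> mspace ?XY" using b by auto
    show "(\<lambda>U. (Some U, None)) ` domains S \<subseteq> domains ?P" by auto
    show "inj_on (\<lambda>U. (Some U, None)) (domains S)" by (auto simp: inj_on_def)
    show "\<forall>U\<in>domains S. \<forall>V\<in>domains S.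
        (nested S U V \<longrightarrow> nested ?P (Some U, None) (Some V, None)) \<and>
        (transverse S U V \<longrightarrow> transverse ?P (Some U, None) (Some V, None)) \<and>
        (orth S U V \<longrightarrow> orth ?P (Some U, None) (Some V, None))"
      by (simp add: transverse_def)
    show "\<exists>q\<ge>1. \<forall>U\<in>domains S. qi_embedding q (hyp_space S U) (hyp_space ?P (Some U, None)) Inl"
      by (intro exI[of _ 1]) (auto simp: qi_embedding_def)
    show "\<exists>r\<ge>0. \<forall>U\<in>domains S. \<forall>x\<in>mspace X. coarsely_equal (hyp_space ?P (Some U, None)) r
        (proj ?P (Some U, None) (x, b)) (Inl ` proj S U x)"
      using proj by (intro exI[of _ 0]) (simp add: coarsely_equal_refl image_mono)
    show "\<exists>r\<ge>0. \<forall>U\<in>domains S. \<forall>V\<in>domains S. U \<noteq> V \<and> \<not> orth S U V \<longrightarrow>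
        (\<forall>p\<in>mspace (hyp_space S U). coarsely_equal (hyp_space ?P (Some V, None)) r
          (Inl ` rho_coarse S U V p) (rho_coarse ?P (Some U, None) (Some V, None) (Inl p)))"
      unfolding rho using hhs_rho_coarse_subset[OF h(2,3)]
      by (intro exI[of _ 0]) (simp add: coarsely_equal_refl image_mono)
  qed

  have "qi_embedding 1 X ?XY (\<lambda>x. (x, b))"
    using b by (auto simp: qi_embedding_def)
  then have qi: "\<exists>q\<ge>1. qi_embedding q X ?XY (\<lambda>x. (x, b))" by blast

  have Yb: "(\<lambda>x. (x, b)) ` mspace X = mspace X \<times> {b}" by auto
  \<comment> \<open>On a domain of the other factor the slice projects to the projection of
    \<open>b\<close> alone, a set of diameter at most \<open>\<xi>'\<close>; this is why
    \<open>\<xi>'\<close> enters the constant next to \<open>K\<close>.\<close>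
  have qc: "quasiconvex (max K \<xi>') (hyp_space ?P W) (proj_image ?P W (mspace X \<times> {b}))"
    if "W \<in> domains ?P" for W
    using that
  proof (cases rule: prod_domains_cases)
    case (left U)
    then have "quasiconvex K (hyp_space S U) (proj_image S U (mspace X))"
      using h(1) unfolding hhs_projections_def by blast
    then have "quasiconvex (max K \<xi>') (hyp_space S U) (proj_image S U (mspace X))"
      by (rule quasiconvex_mono) simp
    then show ?thesis using left by (simp add: quasiconvex_image)
  next
    case (right V)
    then have "proj T V b \<subseteq> mspace (hyp_space T V)" "set_diam (hyp_space T V) (proj T V b) \<le> ennreal \<xi>'"
      using h' b unfolding hhs_projections_def by blast+
    then have "quasiconvex \<xi>' (hyp_space T V) (proj T V b)"
      by (rule quasiconvex_bounded)
    then have "quasiconvex (max K \<xi>') (hyp_space T V) (proj T V b)"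
      by (rule quasiconvex_mono) simp
    then show ?thesis
      using right \<open>mspace X \<noteq> {}\<close> by (simp add: quasiconvex_image)
  next
    case (both U V)
    then show ?thesis using \<open>mspace X \<noteq> {}\<close> by (simp add: quasiconvex_point)
  qed

  have "hhs_uniqueness Y T" using Y unfolding hierarchically_hyperbolic_def by blast
  then obtain \<theta> where \<theta>: "\<And>\<kappa>. \<theta> \<kappa> \<ge> 0" "\<And>\<kappa> x y. \<kappa> \<ge> 0 \<Longrightarrow> x \<in> mspace Y \<Longrightarrow> y \<in> mspace Y \<Longrightarrow>
      \<forall>V\<in>domains T. dist_at T V x y \<le> ennreal \<kappa> \<Longrightarrow> mdist Y x y \<le> \<theta> \<kappa>"
    using hhs_uniqueness_close by blast
  \<comment> \<open>The value at 0 bounds the quasiconvexity of the projections, the values at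
    positive \<kappa> bound the distance to the slice. These conditions do not interact, so the two
    can be chosen independently.\<close>
  define k where "k \<kappa> = (if \<kappa> = 0 then max K \<xi>' else \<theta> \<kappa>)" for \<kappa>
  have close: "set_dist ?XY {z} (mspace X \<times> {b}) \<le> ennreal (k \<kappa>)"
    if \<kappa>: "\<kappa> > 0" and z: "z \<in> mspace ?XY"
      and d: "\<forall>W\<in>domains ?P. dist_at_set ?P W z (proj_image ?P W (mspace X \<times> {b})) \<le> ennreal \<kappa>" for \<kappa> z
  proof -
    obtain x y where [simp]: "z = (x, y)" by (cases z)
    have xy: "x \<in> mspace X" "y \<in> mspace Y" using z by auto
    \<comment> \<open>On \<open>(None, Some V)\<close> closeness to the slice compares
      \<open>y\<close> with \<open>b\<close>. Uniqueness in \<open>T\<close> then bounds the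
      distance from \<open>z\<close> to the slice point \<open>(x, b)\<close>, which differs from
      \<open>z\<close> in the second coordinate only.\<close>
    have "dist_at T V y b \<le> ennreal \<kappa>" if "V \<in> domains T" for V
      using bspec[OF d, of "(None, Some V)"] that \<open>mspace X \<noteq> {}\<close>
      by (simp add: dist_at_def dist_at_set_def)
    then have "mdist Y y b \<le> \<theta> \<kappa>" using \<theta>(2)[of \<kappa> y b] \<kappa> xy b by simp
    then have "mdist ?XY (x, y) (x, b) \<le> k \<kappa>" using xy \<kappa> by (simp add: k_def)
    moreover have "set_dist ?XY {z} (mspace X \<times> {b}) \<le> ennreal (mdist ?XY (x, y) (x, b))"
      using xy by (intro set_dist_le) auto
    ultimately show ?thesis by (meson ennreal_leI order_trans)
  qed
  have "hierarchically_quasiconvex ?XY ?P k ((\<lambda>x. (x, b)) ` mspace X)"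
    unfolding hierarchically_quasiconvex_def Yb
  proof (intro conjI)
    show "mspace X \<times> {b} \<subseteq> mspace ?XY" using b by auto
    show "\<forall>t\<ge>0. k t \<ge> 0" using \<theta>(1) c by (simp add: k_def)
    show "\<forall>U\<in>domains ?P. quasiconvex (k 0) (hyp_space ?P U) (proj_image ?P U (mspace X \<times> {b}))"
      using qc by (simp add: k_def)
  qed (use close in blast)
  then show ?thesis unfolding quasiconvex_hieromorphism_def using hiero qi by blast
qed

text \<open>The mirror image of \<open>quasiconvex_hieromorphism_prod_left\<close>: the slice is now
  \<open>{a} \<times> mspace Y\<close>, and uniqueness in \<open>S\<close> controls the first
  coordinate.\<close>

lemma quasiconvex_hieromorphism_prod_right:
  assumes X: "hierarchically_hyperbolic X S" and Y: "hierarchically_hyperbolic Y T" and a: "a \<in> mspace X"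
  shows "quasiconvex_hieromorphism Y T (l1_prod_metric X Y) (prod_hhs S T)
    (\<lambda>y. (a, y)) (\<lambda>V. (None, Some V)) (\<lambda>_. Inr)"
proof -
  let ?P = "prod_hhs S T" and ?XY = "l1_prod_metric X Y"
  obtain \<xi> K \<kappa> where c: "K \<ge> 0"
    and h: "hhs_projections Y T \<xi> K" "hhs_nesting T \<xi>" "hhs_consistency Y T \<xi> \<kappa>"
    using hierarchically_hyperbolicE[OF Y] .
  obtain \<xi>' K' where h': "hhs_projections X S \<xi>' K'"
    using hierarchically_hyperbolicE[OF X] .
  have "mspace Y \<noteq> {}"
    using Y unfolding hierarchically_hyperbolic_def by (blast dest: hhs_partial_realization_nonempty)
  have proj: "proj T V y \<subseteq> mspace (hyp_space T V)" if "V \<in> domains T" "y \<in> mspace Y" for V y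
    using h(1) that unfolding hhs_projections_def by blast
  have rho: "rho_coarse ?P (None, Some U) (None, Some V) (Inr p) = Inr ` rho_coarse T U V p" for U V p
    by (simp add: rho_coarse_def pnested_def)

  have hiero: "hieromorphism Y T ?XY ?P (\<lambda>y. (a, y)) (\<lambda>V. (None, Some V)) (\<lambda>_. Inr)"
    unfolding hieromorphism_def
  proof (intro conjI)
    show "(\<lambda>y. (a, y)) ` mspace Y \<subseteq> mspace ?XY" using a by auto
    show "(\<lambda>V. (None, Some V)) ` domains T \<subseteq> domains ?P" by auto
    show "inj_on (\<lambda>V. (None, Some V)) (domains T)" by (auto simp: inj_on_def)
    show "\<forall>U\<in>domains T. \<forall>V\<in>domains T.
        (nested T U V \<longrightarrow> nested ?P (None, Some U) (None, Some V)) \<and>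
        (transverse T U V \<longrightarrow> transverse ?P (None, Some U) (None, Some V)) \<and>
        (orth T U V \<longrightarrow> orth ?P (None, Some U) (None, Some V))"
      by (simp add: transverse_def)
    show "\<exists>q\<ge>1. \<forall>V\<in>domains T. qi_embedding q (hyp_space T V) (hyp_space ?P (None, Some V)) Inr"
      by (intro exI[of _ 1]) (auto simp: qi_embedding_def)
    show "\<exists>r\<ge>0. \<forall>V\<in>domains T. \<forall>y\<in>mspace Y. coarsely_equal (hyp_space ?P (None, Some V)) r
        (proj ?P (None, Some V) (a, y)) (Inr ` proj T V y)"
      using proj by (intro exI[of _ 0]) (simp add: coarsely_equal_refl image_mono)
    show "\<exists>r\<ge>0. \<forall>U\<in>domains T. \<forall>V\<in>domains T. U \<noteq> V \<and> \<not> orth T U V \<longrightarrow>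
        (\<forall>p\<in>mspace (hyp_space T U). coarsely_equal (hyp_space ?P (None, Some V)) r
          (Inr ` rho_coarse T U V p) (rho_coarse ?P (None, Some U) (None, Some V) (Inr p)))"
      unfolding rho using hhs_rho_coarse_subset[OF h(2,3)]
      by (intro exI[of _ 0]) (simp add: coarsely_equal_refl image_mono)
  qed

  have "qi_embedding 1 Y ?XY (\<lambda>y. (a, y))"
    using a by (auto simp: qi_embedding_def)
  then have qi: "\<exists>q\<ge>1. qi_embedding q Y ?XY (\<lambda>y. (a, y))" by blast

  have aY: "(\<lambda>y. (a, y)) ` mspace Y = {a} \<times> mspace Y" by auto
  have qc: "quasiconvex (max K \<xi>') (hyp_space ?P W) (proj_image ?P W ({a} \<times> mspace Y))"
    if "W \<in> domains ?P" for W
    using that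
  proof (cases rule: prod_domains_cases)
    case (left U)
    then have "proj S U a \<subseteq> mspace (hyp_space S U)" "set_diam (hyp_space S U) (proj S U a) \<le> ennreal \<xi>'"
      using h' a unfolding hhs_projections_def by blast+
    then have "quasiconvex \<xi>' (hyp_space S U) (proj S U a)"
      by (rule quasiconvex_bounded)
    then have "quasiconvex (max K \<xi>') (hyp_space S U) (proj S U a)"
      by (rule quasiconvex_mono) simp
    then show ?thesis
      using left \<open>mspace Y \<noteq> {}\<close> by (simp add: quasiconvex_image)
  next
    case (right V)
    then have "quasiconvex K (hyp_space T V) (proj_image T V (mspace Y))"
      using h(1) unfolding hhs_projections_def by blast
    then have "quasiconvex (max K \<xi>') (hyp_space T V) (proj_image T V (mspace Y))"
      by (rule quasiconvex_mono) simp
    then show ?thesis using right by (simp add: quasiconvex_image)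
  next
    case (both U V)
    then show ?thesis using \<open>mspace Y \<noteq> {}\<close> by (simp add: quasiconvex_point)
  qed

  have "hhs_uniqueness X S" using X unfolding hierarchically_hyperbolic_def by blast
  then obtain \<theta> where \<theta>: "\<And>\<kappa>. \<theta> \<kappa> \<ge> 0" "\<And>\<kappa> x y. \<kappa> \<ge> 0 \<Longrightarrow> x \<in> mspace X \<Longrightarrow> y \<in> mspace X \<Longrightarrow>
      \<forall>V\<in>domains S. dist_at S V x y \<le> ennreal \<kappa> \<Longrightarrow> mdist X x y \<le> \<theta> \<kappa>"
    using hhs_uniqueness_close by blast
  define k where "k \<kappa> = (if \<kappa> = 0 then max K \<xi>' else \<theta> \<kappa>)" for \<kappa>
  have close: "set_dist ?XY {z} ({a} \<times> mspace Y) \<le> ennreal (k \<kappa>)"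
    if \<kappa>: "\<kappa> > 0" and z: "z \<in> mspace ?XY"
      and d: "\<forall>W\<in>domains ?P. dist_at_set ?P W z (proj_image ?P W ({a} \<times> mspace Y)) \<le> ennreal \<kappa>" for \<kappa> z
  proof -
    obtain x y where [simp]: "z = (x, y)" by (cases z)
    have xy: "x \<in> mspace X" "y \<in> mspace Y" using z by auto
    have "dist_at S U x a \<le> ennreal \<kappa>" if "U \<in> domains S" for U
      using bspec[OF d, of "(Some U, None)"] that \<open>mspace Y \<noteq> {}\<close>
      by (simp add: dist_at_def dist_at_set_def)
    then have "mdist X x a \<le> \<theta> \<kappa>" using \<theta>(2)[of \<kappa> x a] \<kappa> xy a by simp
    then have "mdist ?XY (x, y) (a, y) \<le> k \<kappa>" using xy \<kappa> by (simp add: k_def)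
    moreover have "set_dist ?XY {z} ({a} \<times> mspace Y) \<le> ennreal (mdist ?XY (x, y) (a, y))"
      using xy by (intro set_dist_le) auto
    ultimately show ?thesis by (meson ennreal_leI order_trans)
  qed
  have "hierarchically_quasiconvex ?XY ?P k ((\<lambda>y. (a, y)) ` mspace Y)"
    unfolding hierarchically_quasiconvex_def aY
  proof (intro conjI)
    show "{a} \<times> mspace Y \<subseteq> mspace ?XY" using a by auto
    show "\<forall>t\<ge>0. k t \<ge> 0" using \<theta>(1) c by (simp add: k_def)
    show "\<forall>U\<in>domains ?P. quasiconvex (k 0) (hyp_space ?P U) (proj_image ?P U ({a} \<times> mspace Y))"
      using qc by (simp add: k_def)
  qed (use close in blast)
  then show ?thesis unfolding quasiconvex_hieromorphism_def using hiero qi by blast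
qed

theorem proposition8p27:
  fixes X0 :: "'a metric" and S0 :: "('a, 'i, 'c) hhs_structure"
    and X1 :: "'b metric" and S1 :: "('b, 'j, 'd) hhs_structure"
  assumes "hierarchically_hyperbolic X0 S0"
    and "hierarchically_hyperbolic X1 S1"
  shows "\<exists>S :: ('a \<times> 'b, 'i option \<times> 'j option, 'c + 'd) hhs_structure.
           hierarchically_hyperbolic (l1_prod_metric X0 X1) S \<and>
           (\<forall>b\<in>mspace X1. \<exists>f_dom f_hyp.
              quasiconvex_hieromorphism X0 S0 (l1_prod_metric X0 X1) S (\<lambda>x. (x, b)) f_dom f_hyp) \<and>
           (\<forall>a\<in>mspace X0. \<exists>f_dom f_hyp.
              quasiconvex_hieromorphism X1 S1 (l1_prod_metric X0 X1) S (\<lambda>y. (a, y)) f_dom f_hyp)"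
  \<comment> \<open>The witness \<open>prod_hhs S0 S1\<close> refers to no basepoint, so one
    structure serves the inclusions at all basepoints.\<close>
  using hierarchically_hyperbolic_prod[OF assms] quasiconvex_hieromorphism_prod_left[OF assms]
    quasiconvex_hieromorphism_prod_right[OF assms] by blast

end
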